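(* Let $\Lambda=\{\lambda_n\}_{n=1}^{\infty}$ be a strictly increasing sequence of positive real numbers such that $\sum_{n=1}^{\infty}\frac{1}{\lambda_n}<\infty$ and $\inf_{n}(\lambda_{n+1}-\lambda_n)>0$. Let $\overline{M_\Lambda}$ be the closed span of $M_\Lambda=\{t^{\lambda_n}\}_{n=1}^\infty$ in $L^2(0,1)$, and let $r_\Lambda=\{r_n\}_{n=1}^\infty$ be the unique biorthogonal family of $M_\Lambda$ in $\overline{M_\Lambda}$. Fix a sequence $\{u_n\}_{n=1}^{\infty}$ of distinct non-zero complex numbers such that, for some $0<\rho<1$, $$|u_n|\le\rho^{\lambda_n}\qquad\text{for all } n\in\mathbb{N}.$$ Then the operator $T:\overline{M_\Lambda}\to\overline{M_\Lambda}$ defined by $$T(f)(x):=\sum_{n=1}^{\infty}\langle f,r_n\rangle\, u_n\, x^{\lambda_n}$$ is compact, not normal, and admits Spectral Synthesis.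
   Context: $L^2(0,1)$ is the complex Hilbert space with inner product $\langle f,g\rangle=\int_0^1 f(t)\overline{g(t)}\,dt$. Write $e_n(t)=t^{\lambda_n}$. Under the stated hypotheses on $\Lambda$ the system $\{e_n\}$ is minimal in $L^2(0,1)$ (no $e_n$ belongs to the closed span of the others), so there is a unique family $\{r_n\}_{n=1}^\infty\subset\overline{M_\Lambda}$ biorthogonal to it, i.e. $\langle e_n,r_m\rangle=1$ if $m=n$ and $0$ if $m\neq n$. Spectral Synthesis: let $T$ be a bounded linear operator on a separable Hilbert space $\mathcal{H}$ which has a set of eigenvectors that is complete in $\mathcal{H}$ (its closed linear span is $\mathcal{H}$). $T$ admits Spectral Synthesis if for every (closed) invariant subspace $A$ of $T$, the set of eigenvectors of $T$ contained in $A$ is complete in $A$ (its closed linear span is $A$). *)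

theory Defs
  imports "HOL-Analysis.Analysis"
begin

section \<open>The complex Hilbert space of square-integrable functions on the unit interval\<close>

abbreviation I01 :: "real measure" where
  "I01 \<equiv> lebesgue_on {0<..<1}"

definition square_integrable :: "(real \<Rightarrow> complex) \<Rightarrow> bool" where
  "square_integrable f \<longleftrightarrow>
     f \<in> borel_measurable I01 \<and> integrable I01 (\<lambda>t. (cmod (f t))\<^sup>2)"

lemma square_integrable_zero: "square_integrable (\<lambda>t. 0)"
  by (simp add: square_integrable_def)

lemma square_integrable_add:
  assumes "square_integrable f" "square_integrable g"
  shows "square_integrable (\<lambda>t. f t + g t)"
proof -
  have [measurable]: "f \<in> borel_measurable I01" "g \<in> borel_measurable I01"
    using assms by (auto simp: square_integrable_def)
  have le: "(cmod (a + b))\<^sup>2 \<le> 2 * (cmod a)\<^sup>2 + 2 * (cmod b)\<^sup>2" for a b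
  proof -
    have "(cmod (a + b))\<^sup>2 \<le> (cmod a + cmod b)\<^sup>2"
      by (intro power_mono norm_triangle_ineq norm_ge_zero)
    also have "\<dots> \<le> 2 * (cmod a)\<^sup>2 + 2 * (cmod b)\<^sup>2"
      using zero_le_power2[of "cmod a - cmod b"] by (simp add: power2_eq_square algebra_simps)
    finally show ?thesis .
  qed
  have "integrable I01 (\<lambda>t. 2 * (cmod (f t))\<^sup>2 + 2 * (cmod (g t))\<^sup>2)"
    using assms by (auto simp: square_integrable_def)
  then have "integrable I01 (\<lambda>t. (cmod (f t + g t))\<^sup>2)"
    by (rule Bochner_Integration.integrable_bound) (auto simp: le intro!: AE_I2 order_trans[OF le])
  then show ?thesis by (simp add: square_integrable_def)
qed

lemma square_integrable_mult_const:
  assumes "square_integrable f"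
  shows "square_integrable (\<lambda>t. c * f t)"
  using assms by (auto simp: square_integrable_def norm_mult power_mult_distrib)

lemma square_integrable_scaleR:
  assumes "square_integrable f"
  shows "square_integrable (\<lambda>t. c *\<^sub>R f t)"
  using assms by (auto simp: square_integrable_def power_mult_distrib)

lemma square_integrable_uminus:
  assumes "square_integrable f"
  shows "square_integrable (\<lambda>t. - f t)"
  using assms by (auto simp: square_integrable_def)

lemma integrable_mult_cnj:
  assumes "square_integrable f" "square_integrable g"
  shows "integrable I01 (\<lambda>t. f t * cnj (g t))"
proof -
  have [measurable]: "f \<in> borel_measurable I01" "g \<in> borel_measurable I01"
    using assms by (auto simp: square_integrable_def)
  have le: "cmod (a * cnj b) \<le> (cmod a)\<^sup>2 + (cmod b)\<^sup>2" for a b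
  proof -
    have "2 * (cmod a * cmod b) \<le> (cmod a)\<^sup>2 + (cmod b)\<^sup>2"
      using sum_squares_bound[of "cmod a" "cmod b"] by simp
    then have "cmod a * cmod b \<le> (cmod a)\<^sup>2 + (cmod b)\<^sup>2"
      using mult_nonneg_nonneg[OF norm_ge_zero[of a] norm_ge_zero[of b]] by linarith
    then show ?thesis by (simp add: norm_mult)
  qed
  have meas: "(\<lambda>t. cnj (g t)) \<in> borel_measurable I01"
    by (rule borel_measurable_continuous_on[of cnj]) (auto intro: continuous_intros)
  have "integrable I01 (\<lambda>t. (cmod (f t))\<^sup>2 + (cmod (g t))\<^sup>2)"
    using assms by (auto simp: square_integrable_def)
  then show ?thesis
    by (rule Bochner_Integration.integrable_bound)
       (use meas le in \<open>auto intro!: AE_I2 borel_measurable_times simp: norm_mult\<close>)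
qed

definition L2_rel :: "(real \<Rightarrow> complex) \<Rightarrow> (real \<Rightarrow> complex) \<Rightarrow> bool" where
  "L2_rel f g \<longleftrightarrow>
     square_integrable f \<and> square_integrable g \<and> (AE t in I01. f t = g t)"

text \<open>
  As \<open>L2_rel\<close> is a partial equivalence relation, \<open>abs_L2 f\<close> is the class of \<open>f\<close>
  when \<open>f\<close> is square integrable and carries no information otherwise.
\<close>

quotient_type L2 = "real \<Rightarrow> complex" / partial: L2_rel
proof (rule part_equivpI)
  show "\<exists>f. L2_rel f f"
    by (rule exI[of _ "\<lambda>t. 0"]) (simp add: L2_rel_def square_integrable_zero)
  show "symp L2_rel"
    by (auto simp: L2_rel_def symp_def elim: AE_mp)
  show "transp L2_rel"
    by (auto simp: L2_rel_def transp_def elim: AE_mp)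
qed

lift_definition cinner :: "L2 \<Rightarrow> L2 \<Rightarrow> complex"
  is "\<lambda>f g. integral\<^sup>L I01 (\<lambda>t. f t * cnj (g t))"
proof -
  fix f f' g g' assume a: "L2_rel f f'" "L2_rel g g'"
  note i = a[unfolded L2_rel_def]
  have "integrable I01 (\<lambda>t. f t * cnj (g t))" "integrable I01 (\<lambda>t. f' t * cnj (g' t))"
    using i by (auto intro: integrable_mult_cnj)
  moreover have "AE t in I01. f t * cnj (g t) = f' t * cnj (g' t)"
    using i by auto
  ultimately show "integral\<^sup>L I01 (\<lambda>t. f t * cnj (g t)) = integral\<^sup>L I01 (\<lambda>t. f' t * cnj (g' t))"
    by (intro integral_cong_AE) auto
qed

lift_definition scaleC :: "complex \<Rightarrow> L2 \<Rightarrow> L2"  (infixr \<open>*\<^sub>C\<close> 75)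
  is "\<lambda>c f t. c * f t"
  by (auto simp: L2_rel_def square_integrable_mult_const)

instantiation L2 :: real_vector
begin

lift_definition zero_L2 :: L2 is "\<lambda>t. 0"
  by (simp add: L2_rel_def square_integrable_zero)

lift_definition plus_L2 :: "L2 \<Rightarrow> L2 \<Rightarrow> L2" is "\<lambda>f g t. f t + g t"
  by (auto simp: L2_rel_def square_integrable_add)

lift_definition uminus_L2 :: "L2 \<Rightarrow> L2" is "\<lambda>f t. - f t"
  by (auto simp: L2_rel_def square_integrable_uminus)

definition minus_L2 :: "L2 \<Rightarrow> L2 \<Rightarrow> L2" where
  "minus_L2 f g = f + (- g)"

lift_definition scaleR_L2 :: "real \<Rightarrow> L2 \<Rightarrow> L2" is "\<lambda>c f t. c *\<^sub>R f t"
  by (auto simp: L2_rel_def square_integrable_scaleR)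

instance
proof
  fix f g h :: L2 and a b :: real
  show "f + g + h = f + (g + h)"
    by transfer (simp add: L2_rel_def square_integrable_add algebra_simps)
  show "f + g = g + f"
    by transfer (simp add: L2_rel_def square_integrable_add algebra_simps)
  show "0 + f = f"
    by transfer (simp add: L2_rel_def)
  show "- f + f = 0"
    by transfer (simp add: L2_rel_def square_integrable_zero)
  show "f - g = f + - g"
    by (rule minus_L2_def)
  show "a *\<^sub>R (f + g) = a *\<^sub>R f + a *\<^sub>R g"
    by transfer (simp add: L2_rel_def square_integrable_add square_integrable_scaleR algebra_simps)
  show "(a + b) *\<^sub>R f = a *\<^sub>R f + b *\<^sub>R f"
    by transfer
      (simp add: L2_rel_def square_integrable_add square_integrable_scaleR scaleR_left_distrib)
  show "a *\<^sub>R b *\<^sub>R f = (a * b) *\<^sub>R f"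
    by transfer (simp add: L2_rel_def square_integrable_scaleR)
  show "1 *\<^sub>R f = f"
    by transfer (simp add: L2_rel_def)
qed

end

interpretation scaleC: vector_space scaleC
proof
  fix a b :: complex and f g :: L2
  show "a *\<^sub>C (f + g) = a *\<^sub>C f + a *\<^sub>C g"
    by transfer
      (simp add: L2_rel_def square_integrable_add square_integrable_mult_const ring_distribs)
  show "(a + b) *\<^sub>C f = a *\<^sub>C f + b *\<^sub>C f"
    by transfer
      (simp add: L2_rel_def square_integrable_add square_integrable_mult_const ring_distribs)
  show "a *\<^sub>C b *\<^sub>C f = (a * b) *\<^sub>C f"
    by transfer (simp add: L2_rel_def square_integrable_mult_const)
  show "1 *\<^sub>C f = f"
    by transfer (simp add: L2_rel_def)
qed

lemma scaleR_scaleC: "c *\<^sub>R f = complex_of_real c *\<^sub>C f" for f :: L2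
  by transfer (simp add: L2_rel_def square_integrable_mult_const scaleR_conv_of_real)

lemma cinner_commute: "cinner g f = cnj (cinner f g)"
proof (transfer, goal_cases)
  case (1 g f)
  have "cnj (integral\<^sup>L I01 (\<lambda>t. f t * cnj (g t))) = integral\<^sup>L I01 (\<lambda>t. cnj (f t * cnj (g t)))"
    by (rule Bochner_Integration.integral_cnj[symmetric])
  then show ?case by (simp add: mult.commute)
qed

lemma cinner_add_left: "cinner (f + g) h = cinner f h + cinner g h"
proof (transfer, goal_cases)
  case (1 f g h)
  then show ?case
    by (simp add: L2_rel_def ring_distribs Bochner_Integration.integral_add integrable_mult_cnj)
qed

lemma cinner_scaleC_left: "cinner (c *\<^sub>C f) g = c * cinner f g"
  by transfer (simp add: mult.assoc)

lemma cinner_self: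
  "cinner (abs_L2 f) (abs_L2 f) = of_real (integral\<^sup>L I01 (\<lambda>t. (cmod (f t))\<^sup>2))"
  if "square_integrable f"
proof -
  have "cinner (abs_L2 f) (abs_L2 f) = integral\<^sup>L I01 (\<lambda>t. f t * cnj (f t))"
    using that by (intro cinner.abs_eq) (auto simp: L2_rel_def)
  also have "\<dots> = integral\<^sup>L I01 (\<lambda>t. of_real ((cmod (f t))\<^sup>2))"
    by (simp only: complex_norm_square)
  finally show ?thesis by (simp only: integral_complex_of_real)
qed

lemma L2_cases:
  obtains g where "square_integrable g" "f = abs_L2 g"
  using Quotient_rep_abs[OF Quotient_L2] Quotient_abs_rep[OF Quotient_L2, of f]
    Quotient_rep_reflp[OF Quotient_L2, of f]
  by (auto simp: L2_rel_def)

lemma abs_L2_eq_zero_iff: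
  assumes "square_integrable f"
  shows "abs_L2 f = 0 \<longleftrightarrow> (AE t in I01. f t = 0)"
  using Quotient3_rel[OF Quotient3_L2, of f "\<lambda>t. 0"] assms
  by (auto simp: L2_rel_def square_integrable_zero zero_L2_def)

instantiation L2 :: real_inner
begin

definition inner_L2 :: "L2 \<Rightarrow> L2 \<Rightarrow> real" where
  "inner_L2 f g = Re (cinner f g)"

definition norm_L2 :: "L2 \<Rightarrow> real" where
  "norm_L2 f = sqrt (inner f f)"

definition sgn_L2 :: "L2 \<Rightarrow> L2" where
  "sgn_L2 f = inverse (norm f) *\<^sub>R f"

definition dist_L2 :: "L2 \<Rightarrow> L2 \<Rightarrow> real" where
  "dist_L2 f g = norm (f - g)"

definition uniformity_L2 :: "(L2 \<times> L2) filter" where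
  "uniformity_L2 = (INF e\<in>{0 <..}. principal {(f, g). dist f g < e})"

definition open_L2 :: "L2 set \<Rightarrow> bool" where
  "open_L2 U \<longleftrightarrow> (\<forall>f\<in>U. eventually (\<lambda>(f', g). f' = f \<longrightarrow> g \<in> U) uniformity)"

instance
proof
  fix f g h :: L2 and c :: real and U :: "L2 set"
  show "dist f g = norm (f - g)" by (rule dist_L2_def)
  show "sgn f = inverse (norm f) *\<^sub>R f" by (rule sgn_L2_def)
  show "(uniformity :: (L2 \<times> L2) filter) = (INF e\<in>{0 <..}. principal {(f, g). dist f g < e})"
    by (rule uniformity_L2_def)
  show "open U \<longleftrightarrow> (\<forall>f\<in>U. eventually (\<lambda>(f', g). f' = f \<longrightarrow> g \<in> U) uniformity)"
    by (rule open_L2_def)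
  show "inner f g = inner g f"
    unfolding inner_L2_def by (subst cinner_commute) simp
  show "inner (f + g) h = inner f h + inner g h"
    by (simp add: inner_L2_def cinner_add_left)
  show "inner (c *\<^sub>R f) g = c * inner f g"
    by (simp add: inner_L2_def scaleR_scaleC cinner_scaleC_left)
  show "norm f = sqrt (inner f f)" by (rule norm_L2_def)
  obtain k where k: "square_integrable k" "f = abs_L2 k" by (rule L2_cases)
  have eq: "inner f f = integral\<^sup>L I01 (\<lambda>t. (cmod (k t))\<^sup>2)"
    by (simp add: inner_L2_def k cinner_self)
  show "0 \<le> inner f f" by (simp add: eq)
  have "inner f f = 0 \<longleftrightarrow> (AE t in I01. (cmod (k t))\<^sup>2 = 0)"
    unfolding eq using k(1)
    by (intro integral_nonneg_eq_0_iff_AE) (auto simp: square_integrable_def)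
  then show "inner f f = 0 \<longleftrightarrow> f = 0"
    using k by (simp add: abs_L2_eq_zero_iff)
qed

end

lemma abs_L2_diff:
  assumes "square_integrable f" "square_integrable g"
  shows "abs_L2 f - abs_L2 g = abs_L2 (\<lambda>t. f t - g t)"
  using assms plus_L2.abs_eq[of f "\<lambda>t. - g t"] uminus_L2.abs_eq[of g]
  by (simp add: minus_L2_def L2_rel_def square_integrable_uminus)

lemma square_integrable_diff:
  assumes "square_integrable f" "square_integrable g"
  shows "square_integrable (\<lambda>t. f t - g t)"
  using square_integrable_add[OF assms(1) square_integrable_uminus[OF assms(2)]] by simp

lemma norm_abs_L2:
  assumes "square_integrable f"
  shows "(norm (abs_L2 f))\<^sup>2 = integral\<^sup>L I01 (\<lambda>t. (cmod (f t))\<^sup>2)"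
  unfolding power2_norm_eq_inner inner_L2_def cinner_self[OF assms] by simp

lemma nn_integral_abs_L2:
  assumes "square_integrable f"
  shows "(\<integral>\<^sup>+ t. ennreal ((cmod (f t))\<^sup>2) \<partial>I01) = ennreal ((norm (abs_L2 f))\<^sup>2)"
  unfolding norm_abs_L2[OF assms] using assms
  by (intro nn_integral_eq_integral) (auto simp: square_integrable_def)

lemma nn_integral_norm_le:
  assumes "square_integrable f" "norm (abs_L2 f) \<le> d" "0 < d"
  shows "(\<integral>\<^sup>+ t. ennreal (cmod (f t)) \<partial>I01) \<le> ennreal d"
proof -
  have [measurable]: "f \<in> borel_measurable I01" and int: "integrable I01 (\<lambda>t. (cmod (f t))\<^sup>2)"
    using assms by (auto simp: square_integrable_def)
  have le: "cmod z \<le> (inverse d * (cmod z)\<^sup>2 + d) / 2" for z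
  proof -
    have "2 * (d * cmod z) \<le> (cmod z)\<^sup>2 + d\<^sup>2"
      using sum_squares_bound[of d "cmod z"] by simp
    then show ?thesis using assms(3) by (simp add: field_simps power2_eq_square)
  qed
  have int1: "integrable I01 (\<lambda>t. d)" by (simp add: integrable_restrict_space)
  have "emeasure I01 (space I01) = 1"
    by (simp add: space_restrict_space emeasure_restrict_space)
  then have m: "measure I01 (space I01) = 1" by (simp add: measure_def)
  have "(\<integral>\<^sup>+ t. ennreal (cmod (f t)) \<partial>I01)
      \<le> (\<integral>\<^sup>+ t. ennreal ((inverse d * (cmod (f t))\<^sup>2 + d) / 2) \<partial>I01)"
    by (intro nn_integral_mono ennreal_leI le)
  also have "\<dots> = ennreal (integral\<^sup>L I01 (\<lambda>t. (inverse d * (cmod (f t))\<^sup>2 + d) / 2))"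
    using int int1 assms(3) by (intro nn_integral_eq_integral) auto
  also have "integral\<^sup>L I01 (\<lambda>t. (inverse d * (cmod (f t))\<^sup>2 + d) / 2)
      = (inverse d * (norm (abs_L2 f))\<^sup>2 + d) / 2"
    using int int1 m by (simp add: norm_abs_L2[OF assms(1)])
  also have "\<dots> \<le> (inverse d * d\<^sup>2 + d) / 2"
    using assms by (intro divide_right_mono add_right_mono mult_left_mono power_mono) auto
  also have "\<dots> = d" using assms(3) by (simp add: power2_eq_square)
  finally show ?thesis by (simp add: ennreal_leI)
qed

instance L2 :: banach
proof
  fix X :: "nat \<Rightarrow> L2" assume X: "Cauchy X"
  have "\<exists>N. \<forall>m\<ge>N. \<forall>n\<ge>N. norm (X m - X n) < (1/2) ^ k" for k
    using CauchyD[OF X, of "(1/2) ^ k"] by simp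
  then obtain N where N: "\<And>k m n. m \<ge> N k \<Longrightarrow> n \<ge> N k \<Longrightarrow> norm (X m - X n) < (1/2) ^ k"
    by metis
  define s where "s k = (\<Sum>i\<le>k. N i) + k" for k
  have s_ge: "N k \<le> s k" for k
    unfolding s_def by (rule trans_le_add1) (simp add: member_le_sum)
  have s_mono: "strict_mono s"
    by (rule strict_mono_Suc_iff[THEN iffD2]) (simp add: s_def)
  have s_le: "s j \<le> s k" if "j \<le> k" for j k
    using s_mono that by (simp add: strict_mono_less_eq)
  have "\<exists>h. square_integrable h \<and> X (s k) = abs_L2 h" for k
    by (metis L2_cases)
  then obtain h where h: "\<And>k. square_integrable (h k)" "\<And>k. X (s k) = abs_L2 (h k)"
    by metis
  have [measurable]: "h k \<in> borel_measurable I01" for k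
    using h(1)[of k] by (simp add: square_integrable_def)
  have hdiff: "square_integrable (\<lambda>t. h j t - h k t)" for j k
    by (intro square_integrable_diff h)
  have hX: "abs_L2 (\<lambda>t. h j t - h k t) = X (s j) - X (s k)" for j k
    by (simp add: h(2) abs_L2_diff[OF h(1) h(1)])
  have close: "norm (X (s j) - X (s k)) < (1/2) ^ i" if "i \<le> j" "i \<le> k" for i j k
    using that s_ge[of i] s_le[of i j] s_le[of i k] by (intro N) auto
  have "(\<integral>\<^sup>+ t. (\<Sum>k. ennreal (cmod (h (Suc k) t - h k t))) \<partial>I01)
      = (\<Sum>k. \<integral>\<^sup>+ t. ennreal (cmod (h (Suc k) t - h k t)) \<partial>I01)"
    by (rule nn_integral_suminf) measurable
  also have "\<dots> \<le> (\<Sum>k. ennreal ((1/2) ^ k))"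
    using close by (intro suminf_le nn_integral_norm_le hdiff summableI) (auto simp: hX less_imp_le)
  also have "\<dots> = ennreal (\<Sum>k. (1/2) ^ k)"
    by (intro suminf_ennreal2) (auto simp: summable_geometric)
  also have "\<dots> < \<infinity>" by simp
  finally have "AE t in I01. (\<Sum>k. ennreal (cmod (h (Suc k) t - h k t))) \<noteq> \<infinity>"
    by (intro nn_integral_PInf_AE) auto
  then have conv: "AE t in I01. convergent (\<lambda>k. h k t)"
  proof eventually_elim
    case (elim t)
    then have "summable (\<lambda>k. cmod (h (Suc k) t - h k t))"
      by (intro summable_suminf_not_top) auto
    then have "summable (\<lambda>k. h (Suc k) t - h k t)"
      by (rule summable_norm_cancel)
    then have "convergent (\<lambda>n. \<Sum>k<n. h (Suc k) t - h k t)"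
      by (simp add: summable_iff_convergent)
    then have "convergent (\<lambda>n. h n t - h 0 t)"
      by (simp only: sum_lessThan_telescope[of "\<lambda>k. h k t"])
    then have "convergent (\<lambda>n. (h n t - h 0 t) + h 0 t)"
      by (rule convergent_add[OF _ convergent_const])
    then show ?case by simp
  qed
  define g where "g t = lim (\<lambda>k. h k t)" for t
  have [measurable]: "g \<in> borel_measurable I01"
    unfolding g_def by (rule borel_measurable_lim_metric) measurable
  have lim: "AE t in I01. (\<lambda>k. h k t) \<longlonglongrightarrow> g t"
    using conv by eventually_elim (simp add: g_def convergent_LIMSEQ_iff)
  have fatou: "(\<integral>\<^sup>+ t. ennreal ((cmod (g t - h k t))\<^sup>2) \<partial>I01) \<le> ennreal (((1/2) ^ k)\<^sup>2)" for k
  proof -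
    have "AE t in I01. liminf (\<lambda>j. ennreal ((cmod (h j t - h k t))\<^sup>2))
        = ennreal ((cmod (g t - h k t))\<^sup>2)"
      using lim
      by eventually_elim (intro lim_imp_Liminf tendsto_intros trivial_limit_sequentially)
    then have "(\<integral>\<^sup>+ t. ennreal ((cmod (g t - h k t))\<^sup>2) \<partial>I01)
        = (\<integral>\<^sup>+ t. liminf (\<lambda>j. ennreal ((cmod (h j t - h k t))\<^sup>2)) \<partial>I01)"
      by (intro nn_integral_cong_AE) auto
    also have "\<dots> \<le> liminf (\<lambda>j. \<integral>\<^sup>+ t. ennreal ((cmod (h j t - h k t))\<^sup>2) \<partial>I01)"
      by (rule nn_integral_liminf) measurable
    also have "\<dots> \<le> ennreal (((1/2) ^ k)\<^sup>2)"
    proof (rule Liminf_le)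
      show "\<forall>\<^sub>F j in sequentially. (\<integral>\<^sup>+ t. ennreal ((cmod (h j t - h k t))\<^sup>2) \<partial>I01)
          \<le> ennreal (((1/2) ^ k)\<^sup>2)"
        using eventually_ge_at_top[of k]
      proof eventually_elim
        case (elim j)
        show ?case
          unfolding nn_integral_abs_L2[OF hdiff] hX
          using close[of k j k] elim by (intro ennreal_leI power_mono) auto
      qed
    qed simp
    finally show ?thesis .
  qed
  have gh: "square_integrable (\<lambda>t. g t - h k t)" for k
    unfolding square_integrable_def
    using le_less_trans[OF fatou[of k] ennreal_less_top] by (auto intro!: integrableI_bounded)
  have g: "square_integrable g"
    using square_integrable_add[OF gh[of 0] h(1)[of 0]] by simp
  have ng: "norm (X (s k) - abs_L2 g) \<le> (1/2) ^ k" for k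
  proof -
    have "ennreal ((norm (abs_L2 (\<lambda>t. g t - h k t)))\<^sup>2) \<le> ennreal (((1/2) ^ k)\<^sup>2)"
      using fatou[of k] by (simp add: nn_integral_abs_L2[OF gh])
    then have "(norm (abs_L2 (\<lambda>t. g t - h k t)))\<^sup>2 \<le> ((1/2) ^ k)\<^sup>2"
      by (subst (asm) ennreal_le_iff) auto
    then have "norm (abs_L2 (\<lambda>t. g t - h k t)) \<le> (1/2) ^ k"
      by (rule power2_le_imp_le) simp
    then show ?thesis
      by (simp add: abs_L2_diff[OF g h(1), symmetric] h(2)[symmetric] norm_minus_commute)
  qed
  have "(\<lambda>k. X (s k) - abs_L2 g) \<longlonglongrightarrow> 0"
    by (rule Lim_null_comparison[OF always_eventually LIMSEQ_power_zero[of "1/2 :: real"]])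
       (use ng in auto)
  then have "(X \<circ> s) \<longlonglongrightarrow> abs_L2 g"
    using LIM_zero_cancel by (auto simp: comp_def)
  then have "X \<longlonglongrightarrow> abs_L2 g"
    by (rule Cauchy_converges_subseq[OF X s_mono])
  then show "convergent X" by (rule convergentI)
qed

section \<open>Operators on closed subspaces\<close>

text \<open>
  A Hilbert space in this section is a closed complex subspace \<open>H\<close> of \<open>L2\<close>, and an operator
  on \<open>H\<close> is a function on \<open>L2\<close> of which only the restriction to \<open>H\<close> matters.  Such an \<open>H\<close> is
  automatically separable.
\<close>

definition closed_cspan :: "L2 set \<Rightarrow> L2 set" where
  "closed_cspan S = closure (scaleC.span S)"

definition closed_csubspace :: "L2 set \<Rightarrow> bool" where
  "closed_csubspace A \<longleftrightarrow> closed A \<and> scaleC.subspace A"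

definition linear_operator_on :: "L2 set \<Rightarrow> (L2 \<Rightarrow> L2) \<Rightarrow> bool" where
  "linear_operator_on H T \<longleftrightarrow>
     T \<in> H \<rightarrow> H \<and>
     (\<forall>f\<in>H. \<forall>g\<in>H. T (f + g) = T f + T g) \<and>
     (\<forall>c. \<forall>f\<in>H. T (c *\<^sub>C f) = c *\<^sub>C T f)"

definition bounded_operator_on :: "L2 set \<Rightarrow> (L2 \<Rightarrow> L2) \<Rightarrow> bool" where
  "bounded_operator_on H T \<longleftrightarrow>
     linear_operator_on H T \<and> (\<exists>K. \<forall>f\<in>H. norm (T f) \<le> K * norm f)"

definition compact_operator_on :: "L2 set \<Rightarrow> (L2 \<Rightarrow> L2) \<Rightarrow> bool" where
  "compact_operator_on H T \<longleftrightarrow>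
     linear_operator_on H T \<and> (\<forall>B\<subseteq>H. bounded B \<longrightarrow> compact (closure (T ` B)))"

definition adjoint_on :: "L2 set \<Rightarrow> (L2 \<Rightarrow> L2) \<Rightarrow> (L2 \<Rightarrow> L2) \<Rightarrow> bool" where
  "adjoint_on H T S \<longleftrightarrow>
     S \<in> H \<rightarrow> H \<and> (\<forall>f\<in>H. \<forall>g\<in>H. cinner (T f) g = cinner f (S g))"

text \<open>
  For a bounded operator on \<open>H\<close> the adjoint exists and is unique on \<open>H\<close>, so the quantifier
  merely names it.
\<close>

definition normal_operator_on :: "L2 set \<Rightarrow> (L2 \<Rightarrow> L2) \<Rightarrow> bool" where
  "normal_operator_on H T \<longleftrightarrow>
     (\<exists>S. adjoint_on H T S \<and> (\<forall>f\<in>H. T (S f) = S (T f)))"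

definition eigenvectors_in :: "L2 set \<Rightarrow> (L2 \<Rightarrow> L2) \<Rightarrow> L2 set" where
  "eigenvectors_in A T = {f \<in> A. f \<noteq> 0 \<and> (\<exists>c. T f = c *\<^sub>C f)}"

definition admits_spectral_synthesis :: "L2 set \<Rightarrow> (L2 \<Rightarrow> L2) \<Rightarrow> bool" where
  "admits_spectral_synthesis H T \<longleftrightarrow>
     bounded_operator_on H T \<and>
     closed_cspan (eigenvectors_in H T) = H \<and>
     (\<forall>A. closed_csubspace A \<and> A \<subseteq> H \<and> T ` A \<subseteq> A \<longrightarrow>
        closed_cspan (eigenvectors_in A T) = A)"

section \<open>Systems of powers\<close>

definition power_fun :: "real \<Rightarrow> real \<Rightarrow> complex" where
  "power_fun a = (\<lambda>t. of_real (t powr a))"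

lemma square_integrable_power_fun:
  assumes "0 \<le> a"
  shows "square_integrable (power_fun a)"
proof -
  have m: "(\<lambda>t::real. t powr a) \<in> borel_measurable I01"
    by (rule measurable_restrict_space1, rule measurable_completion) simp
  have "integrable I01 (\<lambda>t. (cmod (power_fun a t))\<^sup>2)"
  proof (rule Bochner_Integration.integrable_bound[where f = "\<lambda>t. 1::real"])
    show "integrable I01 (\<lambda>t. 1::real)"
      by (simp add: integrable_restrict_space)
    show "(\<lambda>t. (cmod (power_fun a t))\<^sup>2) \<in> borel_measurable I01"
      unfolding power_fun_def using m by simp
    have "(t powr a)\<^sup>2 \<le> 1" if "0 < t" "t < 1" for t :: real
      using that assms by (intro power_le_one powr_le1) auto
    then show "AE t in I01. norm ((cmod (power_fun a t))\<^sup>2) \<le> norm (1::real)"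
      by (intro AE_I2) (auto simp: power_fun_def space_restrict_space)
  qed
  moreover have "power_fun a \<in> borel_measurable I01"
    unfolding power_fun_def using m by simp
  ultimately show ?thesis by (simp add: square_integrable_def)
qed

definition power_vec :: "real \<Rightarrow> L2" where
  "power_vec a = abs_L2 (power_fun a)"

definition biorthogonal :: "(nat \<Rightarrow> L2) \<Rightarrow> (nat \<Rightarrow> L2) \<Rightarrow> bool" where
  "biorthogonal e r \<longleftrightarrow> (\<forall>n m. cinner (e n) (r m) = (if m = n then 1 else 0))"

end

theory Submission
  imports Defs
begin

text \<open>
  With \<open>\<mu> n = l n + 1/2\<close> the Gram matrix of the powers is \<open>1/(\<mu> i + \<mu> j)\<close>, so the multiplier
  \<open>(\<mu> - \<mu> k)/(\<mu> + \<mu> k)\<close> is a contraction annihilating the \<open>k\<close>-th power.  Composing these for all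
  \<open>k \<noteq> n\<close> bounds \<open>norm (r n)\<close> by a Blaschke product, and summability of \<open>1/l n\<close> together with the gap
  condition makes this at most \<open>exp (\<epsilon> * \<mu> n)\<close> eventually, for every \<open>\<epsilon> > 0\<close>.  Hence the series for \<open>T\<close>
  converges absolutely, and the dilations \<open>f \<mapsto> \<Sum>n. \<langle>f, r n\<rangle> * s powr \<mu> n * e n\<close> are absolutely convergent
  contractions tending to the identity as \<open>s\<close> tends to \<open>1\<close>: every \<open>f\<close> lies in the closed span of those
  \<open>e n\<close> with \<open>\<langle>f, r n\<rangle> \<noteq> 0\<close>.  If \<open>f\<close> belongs to an invariant subspace, polynomials in \<open>T\<close> isolate each
  of these \<open>e n\<close> inside the subspace, which gives spectral synthesis.
\<close>

section \<open>A lower bound for Blaschke products\<close>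

text \<open>Olivier's theorem: by monotonicity each of the \<open>k - m\<close> terms with index
  from \<open>m\<close> to \<open>k - 1\<close> is at least \<open>1 / \<mu> k\<close>, so a small
  Cauchy tail bounds \<open>(k - m) / \<mu> k\<close>; the remaining \<open>m / \<mu> k\<close>
  tends to 0.\<close>

lemma summable_inverse_imp_sublinear_index:
  fixes \<mu> :: "nat \<Rightarrow> real"
  assumes mono: "mono \<mu>" and pos: "\<And>n. 0 < \<mu> n" and summ: "summable (\<lambda>n. 1 / \<mu> n)"
  shows "(\<lambda>k. real k / \<mu> k) \<longlonglongrightarrow> 0"
proof (rule LIMSEQ_I)
  fix \<eta> :: real assume \<eta>: "0 < \<eta>"
  obtain m where m: "\<And>j n. j \<ge> m \<Longrightarrow> norm (\<Sum>i\<in>{j..<n}. 1 / \<mu> i) < \<eta> / 2"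
    using summ \<eta> unfolding summable_Cauchy by (meson half_gt_zero)
  have "(\<lambda>k. real m * (1 / \<mu> k)) \<longlonglongrightarrow> real m * 0"
    by (intro tendsto_intros summable_LIMSEQ_zero summ)
  then obtain k0 where k0: "\<And>k. k \<ge> k0 \<Longrightarrow> norm (real m * (1 / \<mu> k)) < \<eta> / 2"
    using LIMSEQ_D[of _ 0 "\<eta> / 2"] \<eta> by fastforce
  show "\<exists>no. \<forall>k\<ge>no. norm (real k / \<mu> k - 0) < \<eta>"
  proof (intro exI allI impI)
    fix k assume k: "k \<ge> max m k0"
    have "real (k - m) * (1 / \<mu> k) = (\<Sum>i\<in>{m..<k}. 1 / \<mu> k)"
      by simp
    also have "\<dots> \<le> (\<Sum>i\<in>{m..<k}. 1 / \<mu> i)"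
      by (intro sum_mono divide_left_mono monoD[OF mono] mult_pos_pos pos) auto
    also have "\<dots> < \<eta> / 2" using m[of m k] by simp
    finally have "real (k - m) * (1 / \<mu> k) < \<eta> / 2" .
    moreover have "real m * (1 / \<mu> k) < \<eta> / 2" using k0[of k] k pos[of k] by simp
    moreover have "real k / \<mu> k = real (k - m) * (1 / \<mu> k) + real m * (1 / \<mu> k)"
      using k by (simp add: of_nat_diff diff_divide_distrib)
    ultimately have "real k / \<mu> k < \<eta>" by linarith
    then show "norm (real k / \<mu> k - 0) < \<eta>" using pos[of k] by simp
  qed
qed

text \<open>This is x \<le> exp x at x = \<open>sqrt y\<close>, squared. It lets a product of
  quotients be bounded through a sum of terms \<open>1 / sqrt j\<close>, which grows only like the
  square root of its length.\<close>

lemma le_exp_two_sqrt: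
  fixes y :: real
  assumes "0 \<le> y"
  shows "y \<le> exp (2 * sqrt y)"
proof -
  have "sqrt y \<le> exp (sqrt y)"
    using exp_ge_add_one_self[of "sqrt y"] by linarith
  then have "sqrt y * sqrt y \<le> exp (sqrt y) * exp (sqrt y)"
    using assms by (intro mult_mono) auto
  then show ?thesis using assms by (simp add: exp_add[symmetric])
qed

lemma sum_inverse_sqrt_le: "(\<Sum>j\<in>{1..n}. 1 / sqrt (real j)) \<le> 2 * sqrt (real n)"
proof (induction n)
  case (Suc n)
  \<comment> \<open>Comparison with a telescoping sum: each new term is at most twice the increment
    of the square root, which follows from the square of that increment being nonnegative.\<close>
  have "1 \<le> 2 * sqrt (real (Suc n)) * (sqrt (real (Suc n)) - sqrt (real n))"
  proof -
    have "0 \<le> (sqrt (real (Suc n)) - sqrt (real n))\<^sup>2" by simp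
    then show ?thesis by (simp add: power2_eq_square algebra_simps)
  qed
  then have "1 / sqrt (real (Suc n)) \<le> 2 * (sqrt (real (Suc n)) - sqrt (real n))"
    by (simp add: field_simps)
  with Suc show ?case by simp
qed simp

text \<open>The indices below and above \<open>n\<close> give two sums of \<open>1 / sqrt j\<close>,
  of lengths \<open>n\<close> and \<open>L - n\<close>, each at most
  \<open>2 * sqrt L\<close>.\<close>

lemma sum_inverse_sqrt_distance_le:
  assumes "n \<le> L"
  shows "(\<Sum>k\<in>{..L} - {n}. 1 / sqrt \<bar>real n - real k\<bar>) \<le> 4 * sqrt (real L)"
proof -
  have eq: "{..L} - {n} = {..<n} \<union> {n<..L}" using assms by auto
  have "(\<Sum>k\<in>{..<n}. 1 / sqrt \<bar>real n - real k\<bar>) = (\<Sum>j\<in>{1..n}. 1 / sqrt (real j))"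
    by (rule sum.reindex_bij_witness[of _ "\<lambda>j. n - j" "\<lambda>k. n - k"]) (auto simp: of_nat_diff)
  moreover have "(\<Sum>k\<in>{n<..L}. 1 / sqrt \<bar>real n - real k\<bar>) = (\<Sum>j\<in>{1..L-n}. 1 / sqrt (real j))"
    by (rule sum.reindex_bij_witness[of _ "\<lambda>j. n + j" "\<lambda>k. k - n"]) (auto simp: of_nat_diff)
  moreover have "(\<Sum>k\<in>{..L} - {n}. 1 / sqrt \<bar>real n - real k\<bar>)
      = (\<Sum>k\<in>{..<n}. 1 / sqrt \<bar>real n - real k\<bar>) + (\<Sum>k\<in>{n<..L}. 1 / sqrt \<bar>real n - real k\<bar>)"
    unfolding eq by (rule sum.union_disjoint) auto
  moreover have "sqrt (real n) \<le> sqrt (real L)" "sqrt (real (L - n)) \<le> sqrt (real L)"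
    using assms by auto
  ultimately show ?thesis
    using sum_inverse_sqrt_le[of n] sum_inverse_sqrt_le[of "L - n"] by linarith
qed

lemma gap_imp_distance:
  fixes \<mu> :: "nat \<Rightarrow> real"
  assumes "\<And>n. \<mu> n + \<delta> \<le> \<mu> (Suc n)"
  shows "n \<le> k \<Longrightarrow> \<mu> n + \<delta> * real (k - n) \<le> \<mu> k"
proof (induction k rule: dec_induct)
  case (step k)
  then show ?case using assms[of k] by (simp add: Suc_diff_le algebra_simps)
qed simp

lemma gap_imp_abs_diff_ge:
  fixes \<mu> :: "nat \<Rightarrow> real"
  assumes "\<And>n. \<mu> n + \<delta> \<le> \<mu> (Suc n)" 
  shows "\<delta> * \<bar>real n - real k\<bar> \<le> \<bar>\<mu> n - \<mu> k\<bar>"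
  using gap_imp_distance[of \<mu> \<delta> n k, OF assms] gap_imp_distance[of \<mu> \<delta> k n, OF assms]
  by (cases "n \<le> k") (auto simp: of_nat_diff abs_minus_commute)

text \<open>
  Indices \<open>k\<close> with \<open>\<mu> k \<ge> 2 * \<mu> n\<close> contribute a tail of \<open>\<Sum>1/\<mu> k\<close> times \<open>\<mu> n\<close>; for the
  others the gap condition and \<open>y \<le> exp (2 * sqrt y)\<close> reduce the estimate to
  \<open>\<Sum>1/sqrt j\<close> over a range of length \<open>o(\<mu> n)\<close>.
\<close>

lemma blaschke_product_bound:
  fixes \<mu> :: "nat \<Rightarrow> real"
  assumes pos: "\<And>n. 0 < \<mu> n" and summ: "summable (\<lambda>n. 1 / \<mu> n)"
    and \<delta>: "0 < \<delta>" and gap: "\<And>n. \<mu> n + \<delta> \<le> \<mu> (Suc n)" and \<epsilon>: "0 < \<epsilon>"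
  shows "\<forall>\<^sub>F n in sequentially. \<forall>F. finite F \<longrightarrow> n \<notin> F \<longrightarrow>
           (\<Prod>k\<in>F. (\<mu> n + \<mu> k) / \<bar>\<mu> n - \<mu> k\<bar>) \<le> exp (\<epsilon> * \<mu> n)"
proof -
  have mono: "mono \<mu>" using gap \<delta> by (intro mono_iff_le_Suc[THEN iffD2]) (smt (verit))
  \<comment> \<open>Chosen so that \<open>X * (2 * \<eta> * \<mu> n)\<close> below is exactly the
    square of \<open>\<epsilon> / 16 * \<mu> n\<close>; the near indices then use up half of the
    exponent \<open>\<epsilon> * \<mu> n\<close>.\<close>
  define \<eta> where "\<eta> = \<delta> * (\<epsilon> / 16)\<^sup>2 / 6"
  have \<eta>: "0 < \<eta>" using \<delta> \<epsilon> by (simp add: \<eta>_def)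
  have "\<forall>\<^sub>F k in sequentially. real k / \<mu> k < \<eta>"
    using order_tendstoD(2)[OF summable_inverse_imp_sublinear_index[OF mono pos summ] \<eta>] .
  then obtain n0 where "\<And>k. k \<ge> n0 \<Longrightarrow> real k / \<mu> k < \<eta>"
    by (auto simp: eventually_sequentially)
  then have n0: "real k \<le> \<eta> * \<mu> k" if "k \<ge> n0" for k
    using pos[of k] that by (smt (verit) pos_divide_less_eq)
  obtain n1 where n1: "\<And>j n. j \<ge> n1 \<Longrightarrow> norm (\<Sum>i\<in>{j..<n}. 1 / \<mu> i) < \<epsilon> / 8"
    using summ \<epsilon> unfolding summable_Cauchy
    by (meson divide_pos_pos zero_less_numeral)
  have "(\<Prod>k\<in>F. (\<mu> n + \<mu> k) / \<bar>\<mu> n - \<mu> k\<bar>) \<le> exp (\<epsilon> * \<mu> n)"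
    if n: "n \<ge> max n0 n1" and F: "finite F" "n \<notin> F" for n F
  proof -
    define X where "X = 3 * \<mu> n / \<delta>"
    define N where "N = {k\<in>F. \<mu> k < 2 * \<mu> n}"
    define W where "W = {k\<in>F. 2 * \<mu> n \<le> \<mu> k}"
    have X: "0 < X" using pos[of n] \<delta> by (simp add: X_def)
    have fin: "finite N" "finite W" using F by (auto simp: N_def W_def)
    have FNW: "F = N \<union> W" "N \<inter> W = {}" by (auto simp: N_def W_def)
    have near: "(\<mu> n + \<mu> k) / \<bar>\<mu> n - \<mu> k\<bar> \<le> exp (2 * sqrt X * (1 / sqrt \<bar>real n - real k\<bar>))"
      if k: "k \<in> N" for k
    proof -
      have kn: "k \<noteq> n" and k2: "\<mu> k < 2 * \<mu> n" using k F by (auto simp: N_def)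
      then have d: "0 < \<bar>real n - real k\<bar>" by simp
      \<comment> \<open>The numerator is below \<open>3 * \<mu> n\<close> because
        \<open>\<mu> k < 2 * \<mu> n\<close>; the gap condition bounds the denominator from
        below.\<close>
      have "(\<mu> n + \<mu> k) / \<bar>\<mu> n - \<mu> k\<bar> \<le> 3 * \<mu> n / (\<delta> * \<bar>real n - real k\<bar>)"
        using k2 pos[of n] pos[of k] d \<delta> gap_imp_abs_diff_ge[of \<mu> \<delta> n k, OF gap]
        by (intro frac_le) auto
      also have "\<dots> = X / \<bar>real n - real k\<bar>" by (simp add: X_def)
      also have "\<dots> \<le> exp (2 * sqrt (X / \<bar>real n - real k\<bar>))"
        using X by (intro le_exp_two_sqrt) simp
      finally show ?thesis by (simp add: real_sqrt_divide)
    qed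
    \<comment> \<open>The quotient equals 1 + 2 \<open>\<mu> n\<close> /
      (\<open>\<mu> k - \<mu> n\<close>), and here \<open>\<mu> k - \<mu> n\<close> is at least half
      of \<open>\<mu> k\<close>.\<close>
    have far: "(\<mu> n + \<mu> k) / \<bar>\<mu> n - \<mu> k\<bar> \<le> exp (4 * \<mu> n * (1 / \<mu> k))" if k: "k \<in> W" for k
    proof -
      have k2: "2 * \<mu> n \<le> \<mu> k" using k by (simp add: W_def)
      then have p: "0 < \<mu> k - \<mu> n" using pos[of n] by linarith
      have "0 \<le> \<mu> n * (2 * \<mu> k - 4 * \<mu> n)" using pos[of n] k2 by simp
      then have "(\<mu> n + \<mu> k) * \<mu> k \<le> (\<mu> k + 4 * \<mu> n) * (\<mu> k - \<mu> n)"
        by (simp add: algebra_simps)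
      then have "(\<mu> n + \<mu> k) / (\<mu> k - \<mu> n) \<le> 1 + 4 * \<mu> n * (1 / \<mu> k)"
        using p pos[of k] by (simp add: field_simps)
      also have "\<dots> \<le> exp (4 * \<mu> n * (1 / \<mu> k))" by (rule exp_ge_add_one_self)
      finally show ?thesis using p by simp
    qed
    have farsum: "(\<Sum>k\<in>W. 4 * \<mu> n * (1 / \<mu> k)) \<le> \<epsilon> / 2 * \<mu> n"
    proof -
      obtain m where m: "\<And>k. k \<in> W \<Longrightarrow> k < m" using fin(2) by (meson finite_nat_set_iff_bounded)
      have "n \<le> k" if "k \<in> W" for k
      proof (rule ccontr)
        assume "\<not> n \<le> k"
        then have "\<mu> k \<le> \<mu> n" by (intro monoD[OF mono]) auto
        then show False using that pos[of n] by (simp add: W_def)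
      qed
      then have "(\<Sum>k\<in>W. 1 / \<mu> k) \<le> (\<Sum>k\<in>{n..<m}. 1 / \<mu> k)"
        using m pos by (intro sum_mono2) (auto simp: less_imp_le)
      also have "\<dots> \<le> \<epsilon> / 8" using n1[of n m] n by simp
      finally have "4 * \<mu> n * (\<Sum>k\<in>W. 1 / \<mu> k) \<le> 4 * \<mu> n * (\<epsilon> / 8)"
        using pos[of n] by (intro mult_left_mono) auto
      then show ?thesis by (simp add: sum_distrib_left)
    qed
    have nearsum: "(\<Sum>k\<in>N. 2 * sqrt X * (1 / sqrt \<bar>real n - real k\<bar>)) \<le> \<epsilon> / 2 * \<mu> n"
    proof -
      \<comment> \<open>A cutoff for the near indices: \<open>n\<close> itself is at most
        \<open>\<eta> * \<mu> n\<close>, and a near \<open>k \<ge> n\<close> is at most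
        \<open>\<eta> * \<mu> k\<close>, hence at most \<open>2 * \<eta> * \<mu> n\<close>.\<close>
      define L where "L = nat \<lfloor>2 * \<eta> * \<mu> n\<rfloor>"
      have nn: "real n \<le> \<eta> * \<mu> n" using n0[of n] n by simp
      have p: "0 \<le> \<eta> * \<mu> n" using \<eta> pos[of n] by simp
      have L: "real L \<le> 2 * \<eta> * \<mu> n" using p by (simp add: L_def)
      have kL: "k \<le> L" if "real k \<le> 2 * \<eta> * \<mu> n" for k
        using that by (simp add: L_def le_nat_floor)
      have nL: "n \<le> L" using nn p by (intro kL) simp
      have "N \<subseteq> {..L} - {n}"
      proof
        fix k assume k: "k \<in> N"
        then have kn: "k \<noteq> n" using F by (auto simp: N_def)
        have "k \<le> L"
        proof (cases "n \<le> k")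
          case True
          then have "real k \<le> \<eta> * \<mu> k" using n by (intro n0) simp
          also have "\<dots> \<le> \<eta> * (2 * \<mu> n)" using k \<eta> by (intro mult_left_mono) (auto simp: N_def)
          finally show ?thesis by (intro kL) simp
        qed (use nL in simp)
        with kn show "k \<in> {..L} - {n}" by simp
      qed
      then have "(\<Sum>k\<in>N. 1 / sqrt \<bar>real n - real k\<bar>) \<le> (\<Sum>k\<in>{..L} - {n}. 1 / sqrt \<bar>real n - real k\<bar>)"
        by (intro sum_mono2) auto
      also have "\<dots> \<le> 4 * sqrt (real L)" by (rule sum_inverse_sqrt_distance_le[OF nL])
      also have "\<dots> \<le> 4 * sqrt (2 * \<eta> * \<mu> n)" using L by simp
      finally have "2 * sqrt X * (\<Sum>k\<in>N. 1 / sqrt \<bar>real n - real k\<bar>) \<le> 2 * sqrt X * (4 * sqrt (2 * \<eta> * \<mu> n))"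
        using X by (intro mult_left_mono) auto
      also have "\<dots> = 8 * sqrt (X * (2 * \<eta> * \<mu> n))" by (simp add: real_sqrt_mult)
      also have "X * (2 * \<eta> * \<mu> n) = (\<epsilon> / 16 * \<mu> n)\<^sup>2"
        using \<delta> by (simp add: X_def \<eta>_def power2_eq_square field_simps)
      also have "8 * sqrt \<dots> = \<epsilon> / 2 * \<mu> n" using \<epsilon> pos[of n] by simp
      finally show ?thesis by (simp add: sum_distrib_left)
    qed
    have "(\<Prod>k\<in>F. (\<mu> n + \<mu> k) / \<bar>\<mu> n - \<mu> k\<bar>)
        = (\<Prod>k\<in>N. (\<mu> n + \<mu> k) / \<bar>\<mu> n - \<mu> k\<bar>) * (\<Prod>k\<in>W. (\<mu> n + \<mu> k) / \<bar>\<mu> n - \<mu> k\<bar>)"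
      unfolding FNW(1) by (rule prod.union_disjoint[OF fin FNW(2)])
    also have "\<dots> \<le> (\<Prod>k\<in>N. exp (2 * sqrt X * (1 / sqrt \<bar>real n - real k\<bar>)))
        * (\<Prod>k\<in>W. exp (4 * \<mu> n * (1 / \<mu> k)))"
      using near far pos by (intro mult_mono prod_mono prod_nonneg) (auto simp: less_imp_le)
    also have "\<dots> = exp ((\<Sum>k\<in>N. 2 * sqrt X * (1 / sqrt \<bar>real n - real k\<bar>)) + (\<Sum>k\<in>W. 4 * \<mu> n * (1 / \<mu> k)))"
      by (simp only: exp_sum[OF fin(1)] exp_sum[OF fin(2)] exp_add)
    also have "\<dots> \<le> exp (\<epsilon> * \<mu> n)" using nearsum farsum by simp
    finally show ?thesis .
  qed
  then show ?thesis unfolding eventually_sequentially by blast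
qed

section \<open>The Hilbert space \<open>L2\<close>\<close>

lemma cinner_add_right: "cinner f (g + h) = cinner f g + cinner f h"
  by (subst (1 2 3) cinner_commute) (simp add: cinner_add_left)

lemma cinner_scaleC_right: "cinner f (c *\<^sub>C g) = cnj c * cinner f g"
  by (subst (1 2) cinner_commute) (simp add: cinner_scaleC_left)

lemma cinner_zero_left [simp]: "cinner 0 g = 0"
  using cinner_scaleC_left[of 0 0 g] by simp

lemma cinner_diff_left: "cinner (f - g) h = cinner f h - cinner g h"
  using cinner_add_left[of "f - g" g h] by simp

lemma cinner_diff_right: "cinner f (g - h) = cinner f g - cinner f h"
  using cinner_add_right[of f "g - h" h] by simp

lemma cinner_sum_left: "cinner (\<Sum>i\<in>I. f i) g = (\<Sum>i\<in>I. cinner (f i) g)"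
  by (induction I rule: infinite_finite_induct) (auto simp: cinner_add_left)

lemma cinner_sum_right: "cinner g (\<Sum>i\<in>I. f i) = (\<Sum>i\<in>I. cinner g (f i))"
  by (subst (1 2) cinner_commute) (simp add: cinner_sum_left)

lemma Re_cinner_self: "Re (cinner f f) = (norm f)\<^sup>2"
  by (simp add: power2_norm_eq_inner inner_L2_def)

lemma cinner_self_eq: "cinner f f = of_real ((norm f)\<^sup>2)"
proof -
  have "Im (cinner f f) = 0" using arg_cong[OF cinner_commute[of f f], of Im] by simp
  then show ?thesis by (simp add: complex_eq_iff Re_cinner_self)
qed

lemma norm_scaleC: "norm (c *\<^sub>C f) = cmod c * norm f"
proof -
  have "complex_of_real ((norm (c *\<^sub>C f))\<^sup>2) = (c * cnj c) * cinner f f"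
    by (simp only: cinner_self_eq[symmetric] cinner_scaleC_left cinner_scaleC_right mult.assoc mult.left_commute[of c])
  also have "\<dots> = complex_of_real ((cmod c * norm f)\<^sup>2)"
    by (simp only: cinner_self_eq complex_norm_square[symmetric] of_real_mult[symmetric] power_mult_distrib)
  finally have "(norm (c *\<^sub>C f))\<^sup>2 = (cmod c * norm f)\<^sup>2"
    by (simp only: of_real_eq_iff)
  then show ?thesis by (simp add: power2_eq_iff_nonneg)
qed

lemma cmod_cinner_le: "cmod (cinner f g) \<le> norm f * norm g"
proof (cases "cinner f g = 0")
  case False
  define z where "z = cinner f g"
  \<comment> \<open>A number of modulus one rotating \<open>z\<close> onto the positive axis, so
    that the Cauchy-Schwarz inequality of the real inner product applies to
    \<open>c *\<^sub>C f\<close>.\<close>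
  define c where "c = cnj z / of_real (cmod z)"
  have "c * z = of_real (cmod z)"
    using False complex_norm_square[of z]
    by (simp add: c_def z_def[symmetric] mult.commute[of "cnj z"] divide_eq_eq power2_eq_square)
  then have "cmod (cinner f g) = Re (c * cinner f g)"
    by (simp add: z_def[symmetric])
  also have "\<dots> = inner (c *\<^sub>C f) g" by (simp add: inner_L2_def cinner_scaleC_left)
  also have "\<dots> \<le> norm (c *\<^sub>C f) * norm g" by (rule norm_cauchy_schwarz)
  also have "\<dots> = norm f * norm g" using False by (simp add: norm_scaleC c_def z_def norm_divide)
  finally show ?thesis .
qed simp

lemma bounded_linear_cinner_left: "bounded_linear (\<lambda>f. cinner f g)"
  by (rule bounded_linear_intro[where K = "norm g"])
    (auto simp: cinner_add_left scaleR_scaleC cinner_scaleC_left scaleR_conv_of_real cmod_cinner_le)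

lemma bounded_linear_scaleC_left: "bounded_linear (\<lambda>c. c *\<^sub>C f)"
  by (rule bounded_linear_intro[where K = "norm f"])
    (auto simp: scaleC.scale_left_distrib scaleR_scaleC norm_scaleC scaleR_conv_of_real)

lemma bounded_linear_scaleC_right: "bounded_linear (\<lambda>f. c *\<^sub>C f)"
  by (rule bounded_linear_intro[where K = "cmod c"])
    (auto simp: scaleC.scale_right_distrib scaleR_scaleC norm_scaleC mult_ac)

section \<open>Closed complex spans\<close>

lemma closed_csubspace_closed_cspan: "closed_csubspace (closed_cspan S)"
  unfolding closed_csubspace_def
proof
  show "closed (closed_cspan S)" by (simp add: closed_cspan_def)
  show "scaleC.subspace (closed_cspan S)"
  proof (rule scaleC.subspaceI)
    show "0 \<in> closed_cspan S"
      unfolding closed_cspan_def using scaleC.span_zero closure_subset by blast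
  next
    fix f g assume "f \<in> closed_cspan S" "g \<in> closed_cspan S"
    then obtain a b where "\<And>n::nat. a n \<in> scaleC.span S" "a \<longlonglongrightarrow> f"
      and "\<And>n::nat. b n \<in> scaleC.span S" "b \<longlonglongrightarrow> g"
      unfolding closed_cspan_def closure_sequential by blast
    then show "f + g \<in> closed_cspan S"
      unfolding closed_cspan_def closure_sequential
      by (intro exI[of _ "\<lambda>n. a n + b n"] conjI allI scaleC.span_add tendsto_add)
  next
    fix c f assume "f \<in> closed_cspan S"
    then obtain a where "\<And>n::nat. a n \<in> scaleC.span S" "a \<longlonglongrightarrow> f"
      unfolding closed_cspan_def closure_sequential by blast
    then show "c *\<^sub>C f \<in> closed_cspan S"
      unfolding closed_cspan_def closure_sequential
      by (intro exI[of _ "\<lambda>n. c *\<^sub>C a n"] conjI allI scaleC.span_scale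
          bounded_linear.tendsto[OF bounded_linear_scaleC_right])
  qed
qed

lemma closed_cspan_least: "S \<subseteq> A \<Longrightarrow> closed_csubspace A \<Longrightarrow> closed_cspan S \<subseteq> A"
  unfolding closed_cspan_def closed_csubspace_def
  by (intro closure_minimal scaleC.span_minimal) auto

lemma closed_cspan_superset: "S \<subseteq> closed_cspan S"
  unfolding closed_cspan_def using scaleC.span_superset closure_subset by blast

lemma closed_cspan_mono: "S \<subseteq> S' \<Longrightarrow> closed_cspan S \<subseteq> closed_cspan S'"
  unfolding closed_cspan_def by (intro closure_mono scaleC.span_mono)

lemma closed_csubspace_suminf:
  assumes "closed_csubspace A" "\<And>n. f n \<in> A" "summable f"
  shows "suminf f \<in> A"
proof (rule closed_sequentially)
  show "closed A" using assms by (simp add: closed_csubspace_def)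
  show "(\<lambda>n. \<Sum>k<n. f k) \<longlonglongrightarrow> suminf f"
    using assms(3) by (rule summable_LIMSEQ)
  show "(\<Sum>k<n. f k) \<in> A" for n
    using assms by (auto simp: closed_csubspace_def intro: scaleC.subspace_sum)
qed

section \<open>Powers and absolutely convergent power series in \<open>L2\<close>\<close>

lemma cinner_power_vec:
  assumes "0 \<le> a" "0 \<le> b"
  shows "cinner (power_vec a) (power_vec b) = of_real (1 / (a + b + 1))"
proof -
  have "cinner (power_vec a) (power_vec b) = integral\<^sup>L I01 (\<lambda>t. power_fun a t * cnj (power_fun b t))"
    unfolding power_vec_def
    by (intro cinner.abs_eq) (auto simp: L2_rel_def square_integrable_power_fun assms)
  also have "\<dots> = integral\<^sup>L I01 (\<lambda>t. complex_of_real (t powr (a + b)))"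
    by (simp add: power_fun_def powr_add)
  also have "\<dots> = of_real (integral\<^sup>L I01 (\<lambda>t. t powr (a + b)))"
    by (rule integral_complex_of_real)
  also have "integral\<^sup>L I01 (\<lambda>t. t powr (a + b)) = 1 / (a + b + 1)"
  proof -
    have "integrable I01 (\<lambda>t. power_fun a t * cnj (power_fun b t))"
      by (intro integrable_mult_cnj square_integrable_power_fun assms)
    then have "integrable I01 (\<lambda>t. complex_of_real (t powr (a + b)))"
      by (simp add: power_fun_def powr_add)
    then have "integrable I01 (\<lambda>t. t powr (a + b))"
      by (simp only: complex_of_real_integrable_eq)
    then have "integral\<^sup>L I01 (\<lambda>t. t powr (a + b)) = integral {0<..<1} (\<lambda>t. t powr (a + b))"
      by (rule lebesgue_integral_eq_integral) simp
    also have "\<dots> = integral {0..1} (\<lambda>t. t powr (a + b))"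
      using integral_open_interval_real[of 0 1 "\<lambda>t. t powr (a + b)"] by simp
    also have "\<dots> = 1 / (a + b + 1)"
      using has_integral_powr_from_0[of "a + b" 1] assms by (simp add: integral_unique)
    finally show ?thesis .
  qed
  finally show ?thesis .
qed

lemma norm_power_vec_le_1: "0 \<le> a \<Longrightarrow> norm (power_vec a) \<le> 1"
proof -
  assume a: "0 \<le> a"
  have "(norm (power_vec a))\<^sup>2 = 1 / (a + a + 1)"
    by (simp only: Re_cinner_self[symmetric] cinner_power_vec[OF a a] Re_complex_of_real)
  also have "\<dots> \<le> 1\<^sup>2" using a by simp
  finally show ?thesis by (rule power2_le_imp_le) simp
qed

lemma norm_abs_L2_le:
  assumes "square_integrable f" "\<And>t. t \<in> {0<..<1} \<Longrightarrow> cmod (f t) \<le> K" "0 \<le> K"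
  shows "norm (abs_L2 f) \<le> K"
proof -
  have int: "integrable I01 (\<lambda>t. K\<^sup>2)" by (simp add: integrable_restrict_space)
  have "emeasure I01 (space I01) = 1"
    by (simp add: space_restrict_space emeasure_restrict_space)
  then have m: "measure I01 (space I01) = 1" by (simp add: measure_def)
  have "(norm (abs_L2 f))\<^sup>2 \<le> integral\<^sup>L I01 (\<lambda>t. K\<^sup>2)"
    unfolding norm_abs_L2[OF assms(1)]
    using assms int by (intro integral_mono) (auto simp: square_integrable_def space_restrict_space power_mono)
  also have "\<dots> = K\<^sup>2" using m by simp
  finally show ?thesis using assms(3) by (rule power2_le_imp_le)
qed

lemma square_integrable_bounded:
  assumes "f \<in> borel_measurable I01" "\<And>t. t \<in> {0<..<1} \<Longrightarrow> cmod (f t) \<le> K"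
  shows "square_integrable f"
  unfolding square_integrable_def
proof
  show "integrable I01 (\<lambda>t. (cmod (f t))\<^sup>2)"
  proof (rule Bochner_Integration.integrable_bound[where f = "\<lambda>t. K\<^sup>2"])
    show "integrable I01 (\<lambda>t. K\<^sup>2)" by (simp add: integrable_restrict_space)
    show "(\<lambda>t. (cmod (f t))\<^sup>2) \<in> borel_measurable I01" using assms(1) by measurable
    show "AE t in I01. norm ((cmod (f t))\<^sup>2) \<le> norm (K\<^sup>2)"
      using assms(2) by (intro AE_I2) (auto simp: space_restrict_space power_mono)
  qed
qed (fact assms(1))

lemma cmod_power_fun_le_1: "0 \<le> a \<Longrightarrow> t \<in> {0<..<1} \<Longrightarrow> cmod (power_fun a t) \<le> 1"
  by (simp add: power_fun_def powr_le1)

lemma abs_L2_sum: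
  assumes "\<And>i. i \<in> I \<Longrightarrow> square_integrable (f i)"
  shows "square_integrable (\<lambda>x. \<Sum>i\<in>I. f i x) \<and> abs_L2 (\<lambda>x. \<Sum>i\<in>I. f i x) = (\<Sum>i\<in>I. abs_L2 (f i))"
  using assms
proof (induction I rule: infinite_finite_induct)
  case (insert i I)
  then show ?case
    using plus_L2.abs_eq[of "f i" "\<lambda>x. \<Sum>i\<in>I. f i x"]
    by (auto simp: L2_rel_def square_integrable_add)
qed (auto simp: square_integrable_zero zero_L2_def)

lemma abs_L2_scaleC: "square_integrable f \<Longrightarrow> abs_L2 (\<lambda>x. c * f x) = c *\<^sub>C abs_L2 f"
  using scaleC.abs_eq[of f c] by (simp add: L2_rel_def)

text \<open>Identifies the pointwise series in the definition of \<open>T\<close> with a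
  norm-convergent series of vectors. Powers are at most 1 on the interval, so the coefficient tails
  bound the remainders uniformly, and on a space of measure one a uniform bound is an
  \<open>L2\<close> bound.\<close>

lemma
  fixes c :: "nat \<Rightarrow> complex" and a :: "nat \<Rightarrow> real"
  assumes c: "summable (\<lambda>n. cmod (c n))" and a: "\<And>n. 0 \<le> a n"
  shows power_series_summable: "x \<in> {0<..<1} \<Longrightarrow> summable (\<lambda>n. c n * power_fun (a n) x)"
    and power_series_square_integrable: "square_integrable (\<lambda>x. \<Sum>n. c n * power_fun (a n) x)"
    and power_series_summable_L2: "summable (\<lambda>n. c n *\<^sub>C power_vec (a n))"
    and abs_L2_power_series: "abs_L2 (\<lambda>x. \<Sum>n. c n * power_fun (a n) x) = (\<Sum>n. c n *\<^sub>C power_vec (a n))"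
proof -
  define s where "s x = (\<Sum>n. c n * power_fun (a n) x)" for x
  define p where "p N x = (\<Sum>n<N. c n * power_fun (a n) x)" for N x
  have le: "cmod (c n * power_fun (a n) x) \<le> cmod (c n)" if "x \<in> {0<..<1}" for n x
    using mult_left_mono[OF cmod_power_fun_le_1[OF a that], of "cmod (c n)" n] by (simp add: norm_mult)
  have sn: "summable (\<lambda>n. cmod (c n * power_fun (a n) x))" if "x \<in> {0<..<1}" for x
    by (rule summable_comparison_test'[OF c, where N = 0]) (use le[OF that] in simp)
  have s: "summable (\<lambda>n. c n * power_fun (a n) x)" if "x \<in> {0<..<1}" for x
    by (rule summable_norm_cancel[OF sn[OF that]])
  then show "x \<in> {0<..<1} \<Longrightarrow> summable (\<lambda>n. c n * power_fun (a n) x)" .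
  have [measurable]: "power_fun (a n) \<in> borel_measurable I01" for n
    using square_integrable_power_fun[OF a] by (simp add: square_integrable_def)
  have sm: "s \<in> borel_measurable I01" unfolding s_def by measurable
  have "cmod (s x) \<le> (\<Sum>n. cmod (c n))" if "x \<in> {0<..<1}" for x
  proof -
    have "cmod (s x) \<le> (\<Sum>n. cmod (c n * power_fun (a n) x))"
      unfolding s_def by (intro summable_norm sn that)
    also have "\<dots> \<le> (\<Sum>n. cmod (c n))" by (intro suminf_le le sn that c)
    finally show ?thesis .
  qed
  then have sq: "square_integrable s" by (rule square_integrable_bounded[OF sm])
  then show "square_integrable (\<lambda>x. \<Sum>n. c n * power_fun (a n) x)" by (simp add: s_def[abs_def])
  have pe: "square_integrable (\<lambda>x. c n * power_fun (a n) x)" for n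
    by (intro square_integrable_mult_const square_integrable_power_fun a)
  have p: "square_integrable (p N)" "abs_L2 (p N) = (\<Sum>n<N. c n *\<^sub>C power_vec (a n))" for N
    unfolding p_def
    using abs_L2_sum[of "{..<N}" "\<lambda>n x. c n * power_fun (a n) x"] pe
    by (auto simp: power_vec_def abs_L2_scaleC square_integrable_power_fun a)
  have bound: "norm (abs_L2 s - abs_L2 (p N)) \<le> (\<Sum>n. cmod (c (n + N)))" for N
  proof -
    have sN: "summable (\<lambda>n. cmod (c (n + N)))" using summable_ignore_initial_segment[OF c] .
    have "cmod (s x - p N x) \<le> (\<Sum>n. cmod (c (n + N)))" if x: "x \<in> {0<..<1}" for x
    proof -
      have snN: "summable (\<lambda>n. cmod (c (n + N) * power_fun (a (n + N)) x))"
        using summable_ignore_initial_segment[OF sn[OF x], of N] .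
      have "s x - p N x = (\<Sum>n. c (n + N) * power_fun (a (n + N)) x)"
        unfolding s_def p_def by (subst suminf_split_initial_segment[OF s[OF x], of N]) simp
      also have "cmod \<dots> \<le> (\<Sum>n. cmod (c (n + N) * power_fun (a (n + N)) x))"
        by (rule summable_norm[OF snN])
      also have "\<dots> \<le> (\<Sum>n. cmod (c (n + N)))"
        by (intro suminf_le le x sN snN)
      finally show ?thesis .
    qed
    then show ?thesis
      unfolding abs_L2_diff[OF sq p(1)]
      by (intro norm_abs_L2_le square_integrable_diff sq p(1) suminf_nonneg sN norm_ge_zero)
  qed
  have "(\<lambda>N. \<Sum>n. cmod (c (n + N))) \<longlonglongrightarrow> 0"
  proof -
    have "(\<lambda>N. (\<Sum>n. cmod (c n)) - (\<Sum>n<N. cmod (c n))) \<longlonglongrightarrow> (\<Sum>n. cmod (c n)) - (\<Sum>n. cmod (c n))"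
      by (intro tendsto_intros summable_LIMSEQ c)
    then show ?thesis by (simp add: suminf_minus_initial_segment[OF c])
  qed
  then have "(\<lambda>N. abs_L2 s - abs_L2 (p N)) \<longlonglongrightarrow> 0"
    by (rule Lim_null_comparison[rotated]) (use bound in auto)
  then have "(\<lambda>N. abs_L2 s - (abs_L2 s - abs_L2 (p N))) \<longlonglongrightarrow> abs_L2 s - 0"
    by (intro tendsto_intros)
  then have "(\<lambda>n. c n *\<^sub>C power_vec (a n)) sums abs_L2 s"
    by (simp add: sums_def p(2))
  then show "summable (\<lambda>n. c n *\<^sub>C power_vec (a n))"
    and "abs_L2 (\<lambda>x. \<Sum>n. c n * power_fun (a n) x) = (\<Sum>n. c n *\<^sub>C power_vec (a n))"
    by (auto simp: sums_iff s_def[abs_def])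
qed

section \<open>Multipliers on spans of powers\<close>

lemma norm_power_sum:
  assumes "\<And>k. 0 \<le> a k"
  shows "complex_of_real ((norm (\<Sum>k\<in>I. c k *\<^sub>C power_vec (a k)))\<^sup>2)
    = (\<Sum>i\<in>I. \<Sum>j\<in>I. c i * cnj (c j) * of_real (1 / (a i + a j + 1)))"
  unfolding cinner_self_eq[symmetric]
  by (simp add: cinner_sum_left cinner_sum_right cinner_scaleC_left cinner_scaleC_right
      cinner_power_vec assms mult_ac sum_distrib_left) (rule sum.swap)

text \<open>
  With \<open>\<mu> = a + 1/2\<close> and \<open>b = (\<mu> - \<kappa>)/(\<mu> + \<kappa>)\<close>, the Gram matrix \<open>1/(\<mu> i + \<mu> j)\<close> satisfies
  \<open>(1 - b i * b j)/(\<mu> i + \<mu> j) = 2*\<kappa>/((\<mu> i + \<kappa>)*(\<mu> j + \<kappa>))\<close>, a positive matrix of rank one: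
  the multiplier \<open>b\<close> is the adjoint of multiplication by a Blaschke factor in the Hardy space.
\<close>

lemma norm_blaschke_multiplier_le:
  assumes a: "\<And>k. 0 \<le> a k" and \<kappa>: "0 < \<kappa>"
  shows "norm (\<Sum>k\<in>I. (c k * of_real ((a k + 1/2 - \<kappa>) / (a k + 1/2 + \<kappa>))) *\<^sub>C power_vec (a k))
    \<le> norm (\<Sum>k\<in>I. c k *\<^sub>C power_vec (a k))" (is "norm ?g \<le> norm ?f")
proof -
  define b where "b k = (a k + 1/2 - \<kappa>) / (a k + 1/2 + \<kappa>)" for k
  define d where "d k = 1 / (a k + 1/2 + \<kappa>)" for k
  define S where "S = (\<Sum>k\<in>I. c k * of_real (d k))"
  have bd: "1 / (a i + a j + 1) - b i * b j * (1 / (a i + a j + 1)) = 2 * \<kappa> * (d i * d j)" for i j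
  proof -
    have ne: "a i + 1/2 + \<kappa> \<noteq> 0" "a j + 1/2 + \<kappa> \<noteq> 0" "a i + a j + 1 \<noteq> 0"
      using a[of i] a[of j] \<kappa> by linarith+
    have "(a i + 1/2 + \<kappa>) * (a j + 1/2 + \<kappa>) - (a i + 1/2 - \<kappa>) * (a j + 1/2 - \<kappa>)
        = 2 * \<kappa> * (a i + a j + 1)"
      by (simp add: algebra_simps)
    moreover have "1 - b i * b j = ((a i + 1/2 + \<kappa>) * (a j + 1/2 + \<kappa>) - (a i + 1/2 - \<kappa>) * (a j + 1/2 - \<kappa>))
        * (d i * d j)"
    proof -
      have "(a i + 1/2 + \<kappa>) * (a j + 1/2 + \<kappa>) * (d i * d j) = 1"
        using ne(1,2) by (simp add: d_def)
      moreover have "(a i + 1/2 - \<kappa>) * (a j + 1/2 - \<kappa>) * (d i * d j) = b i * b j"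
        by (simp add: b_def d_def)
      ultimately show ?thesis by (simp only: left_diff_distrib)
    qed
    ultimately have "1 - b i * b j = 2 * \<kappa> * (a i + a j + 1) * (d i * d j)" by simp
    then have "(1 - b i * b j) * (1 / (a i + a j + 1)) = 2 * \<kappa> * (d i * d j)"
      using ne(3) by simp
    then show ?thesis by (simp add: diff_divide_distrib)
  qed
  have g: "?g = (\<Sum>k\<in>I. (c k * of_real (b k)) *\<^sub>C power_vec (a k))" by (simp only: b_def)
  have "complex_of_real ((norm ?f)\<^sup>2 - (norm ?g)\<^sup>2)
      = (\<Sum>i\<in>I. \<Sum>j\<in>I. c i * cnj (c j) * of_real (1 / (a i + a j + 1) - b i * b j * (1 / (a i + a j + 1))))"
    unfolding of_real_diff g norm_power_sum[of a, OF a] sum_subtractf[symmetric]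
    by (intro sum.cong refl)
      (simp only: of_real_diff of_real_mult complex_cnj_mult complex_cnj_complex_of_real right_diff_distrib mult_ac)
  also have "\<dots> = of_real (2 * \<kappa>) * (S * cnj S)"
    unfolding bd S_def cnj_sum sum_product
    unfolding sum_distrib_left
    by (intro sum.cong refl) (simp add: mult_ac)
  also have "\<dots> = of_real (2 * \<kappa> * (cmod S)\<^sup>2)"
    by (simp only: complex_norm_square of_real_mult)
  finally have "(norm ?f)\<^sup>2 - (norm ?g)\<^sup>2 = 2 * \<kappa> * (cmod S)\<^sup>2"
    by (simp only: of_real_eq_iff)
  moreover have "0 \<le> 2 * \<kappa> * (cmod S)\<^sup>2" using \<kappa> by simp
  ultimately have "(norm ?g)\<^sup>2 \<le> (norm ?f)\<^sup>2" by linarith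
  then show ?thesis by (rule power2_le_imp_le[OF _ norm_ge_zero])
qed

text \<open>Each factor is the contractive multiplier above with
  \<open>\<kappa> = a j + 1/2\<close>; contractions are composed one index at a time.\<close>

lemma norm_blaschke_product_multiplier_le:
  assumes a: "\<And>k. 0 \<le> a k" and "finite F"
  shows "norm (\<Sum>k\<in>I. (c k * of_real (\<Prod>j\<in>F. (a k - a j) / (a k + a j + 1))) *\<^sub>C power_vec (a k))
    \<le> norm (\<Sum>k\<in>I. c k *\<^sub>C power_vec (a k))"
  using \<open>finite F\<close>
proof (induction F)
  case (insert m F)
  let ?c = "\<lambda>k. c k * of_real (\<Prod>j\<in>F. (a k - a j) / (a k + a j + 1))"
  have eq: "(\<Sum>k\<in>I. (c k * of_real (\<Prod>j\<in>insert m F. (a k - a j) / (a k + a j + 1))) *\<^sub>C power_vec (a k))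
      = (\<Sum>k\<in>I. (?c k * of_real ((a k + 1/2 - (a m + 1/2)) / (a k + 1/2 + (a m + 1/2)))) *\<^sub>C power_vec (a k))"
    using insert.hyps by (intro sum.cong refl) (simp add: mult_ac add_ac)
  have "norm (\<Sum>k\<in>I. (?c k * of_real ((a k + 1/2 - (a m + 1/2)) / (a k + 1/2 + (a m + 1/2)))) *\<^sub>C power_vec (a k))
      \<le> norm (\<Sum>k\<in>I. ?c k *\<^sub>C power_vec (a k))"
    using a[of m] by (intro norm_blaschke_multiplier_le a add_nonneg_pos) auto
  from order_trans[OF this insert.IH] show ?case unfolding eq .
qed simp

text \<open>The Blaschke multiplier with zeros at all exponents in \<open>I\<close> except
  \<open>a n\<close> kills every other term. What survives is the \<open>n\<close>-th term times a
  factor whose modulus is the reciprocal of the product on the right.\<close>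

lemma coefficient_le_norm_power_sum:
  assumes a: "\<And>k. 0 \<le> a k" "inj_on a I" and I: "finite I" "n \<in> I"
  shows "cmod (c n) * norm (power_vec (a n))
    \<le> (\<Prod>k\<in>I - {n}. (a n + a k + 1) / \<bar>a n - a k\<bar>) * norm (\<Sum>k\<in>I. c k *\<^sub>C power_vec (a k))"
proof -
  let ?P = "\<lambda>k. \<Prod>j\<in>I - {n}. (a k - a j) / (a k + a j + 1)"
  define Q where "Q = (\<Prod>k\<in>I - {n}. (a n + a k + 1) / \<bar>a n - a k\<bar>)"
  have ne: "a n \<noteq> a k" if "k \<in> I - {n}" for k
    using that inj_onD[OF a(2), of n k] I by auto
  have p: "0 < a n + a k + 1" for k using a(1)[of n] a(1)[of k] by linarith
  have "Q * \<bar>?P n\<bar> = (\<Prod>k\<in>I - {n}. (a n + a k + 1) / \<bar>a n - a k\<bar> * \<bar>(a n - a k) / (a n + a k + 1)\<bar>)"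
    unfolding Q_def abs_prod prod.distrib ..
  also have "\<dots> = 1"
  proof (intro prod.neutral ballI)
    fix k assume k: "k \<in> I - {n}"
    have "a n + a k + 1 \<noteq> 0" using p[of k] by simp
    then show "(a n + a k + 1) / \<bar>a n - a k\<bar> * \<bar>(a n - a k) / (a n + a k + 1)\<bar> = 1"
      using ne[OF k] by (simp add: abs_divide abs_of_pos[OF p])
  qed
  finally have Q1: "Q * \<bar>?P n\<bar> = 1" .
  have Q0: "0 \<le> Q" unfolding Q_def using p by (intro prod_nonneg) (auto simp: less_imp_le)
  have "(\<Sum>k\<in>I. (c k * of_real (?P k)) *\<^sub>C power_vec (a k)) = (c n * of_real (?P n)) *\<^sub>C power_vec (a n)"
    using I by (subst sum.remove[OF I]) (auto intro!: sum.neutral simp: prod_zero_iff)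
  then have "cmod (c n) * \<bar>?P n\<bar> * norm (power_vec (a n)) \<le> norm (\<Sum>k\<in>I. c k *\<^sub>C power_vec (a k))"
    using norm_blaschke_product_multiplier_le[where a = a and F = "I - {n}" and I = I and c = c, OF a(1)] I
    by (simp only: norm_scaleC norm_mult norm_of_real finite_Diff)
  then have "Q * (cmod (c n) * \<bar>?P n\<bar> * norm (power_vec (a n))) \<le> Q * norm (\<Sum>k\<in>I. c k *\<^sub>C power_vec (a k))"
    by (intro mult_left_mono Q0)
  moreover have "Q * (cmod (c n) * \<bar>?P n\<bar> * norm (power_vec (a n))) = Q * \<bar>?P n\<bar> * (cmod (c n) * norm (power_vec (a n)))"
    by (simp only: mult_ac)
  ultimately have "cmod (c n) * norm (power_vec (a n)) \<le> Q * norm (\<Sum>k\<in>I. c k *\<^sub>C power_vec (a k))"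
    by (simp only: Q1 mult_1)
  then show ?thesis by (simp only: Q_def)
qed

text \<open>
  The multiplier \<open>s powr (a + 1/2)\<close> is the contraction \<open>f \<mapsto> (\<lambda>t. sqrt s * f (s * t))\<close>.  In terms of the
  Gram matrix, the squared norm has derivative \<open>(cmod (\<Sum>k. c k * s powr a k))\<^sup>2\<close> in \<open>s\<close>.
\<close>

lemma norm_dilation_multiplier_le:
  assumes a: "\<And>k. 0 \<le> a k" and s: "0 < s" "s \<le> 1"
  shows "norm (\<Sum>k\<in>I. (c k * of_real (s powr (a k + 1/2))) *\<^sub>C power_vec (a k))
    \<le> norm (\<Sum>k\<in>I. c k *\<^sub>C power_vec (a k))"
proof -
  define g where "g x = (\<Sum>k\<in>I. (c k * of_real (x powr (a k + 1/2))) *\<^sub>C power_vec (a k))" for x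
  define G where "G x = (\<Sum>i\<in>I. \<Sum>j\<in>I. Re (c i * cnj (c j)) * (x powr (a i + a j + 1) / (a i + a j + 1)))" for x
  have G: "(norm (g x))\<^sup>2 = G x" if "0 < x" for x
  proof -
    have "(norm (g x))\<^sup>2 = Re (complex_of_real ((norm (g x))\<^sup>2))" by simp
    also have "\<dots> = (\<Sum>i\<in>I. \<Sum>j\<in>I. Re (c i * cnj (c j) *
        of_real (x powr (a i + 1/2) * x powr (a j + 1/2) / (a i + a j + 1))))"
      unfolding g_def norm_power_sum[of a, OF a] Re_sum by (intro sum.cong refl) (simp add: mult_ac)
    also have "\<dots> = G x"
      unfolding G_def using that
      by (intro sum.cong refl) (simp add: powr_add[symmetric] add_ac)
    finally show ?thesis .
  qed
  have "G s \<le> G 1"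
  proof (rule DERIV_nonneg_imp_nondecreasing[OF s(2)])
    fix x assume "s \<le> x" "x \<le> 1"
    then have x: "0 < x" using s by simp
    define S where "S = (\<Sum>k\<in>I. c k * of_real (x powr a k))"
    have "(G has_real_derivative (\<Sum>i\<in>I. \<Sum>j\<in>I. Re (c i * cnj (c j)) * x powr (a i + a j))) (at x)"
      unfolding G_def
    proof (intro DERIV_sum DERIV_cmult)
      fix i j
      have p: "a i + a j + 1 \<noteq> 0" using a[of i] a[of j] by linarith
      have "((\<lambda>x. x powr (a i + a j + 1)) has_real_derivative (a i + a j + 1) * x powr (a i + a j + 1 - 1)) (at x)"
        by (rule has_real_derivative_powr[OF x])
      from DERIV_cdivide[OF this, of "a i + a j + 1"] p
      show "((\<lambda>x. x powr (a i + a j + 1) / (a i + a j + 1)) has_real_derivative x powr (a i + a j)) (at x)"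
        by simp
    qed
    moreover have "(\<Sum>i\<in>I. \<Sum>j\<in>I. Re (c i * cnj (c j)) * x powr (a i + a j)) = Re (S * cnj S)"
      unfolding S_def cnj_sum sum_product Re_sum
      by (intro sum.cong refl) (simp add: powr_add algebra_simps)
    moreover have "0 \<le> Re (S * cnj S)" by simp
    ultimately show "\<exists>y. (G has_real_derivative y) (at x) \<and> 0 \<le> y" by metis
  qed
  then have "(norm (g s))\<^sup>2 \<le> (norm (g 1))\<^sup>2" using G s by simp
  then have "norm (g s) \<le> norm (g 1)" by (rule power2_le_imp_le) simp
  then show ?thesis by (simp add: g_def)
qed

section \<open>Biorthogonal expansions\<close>

locale muntz_system =
  fixes l :: "nat \<Rightarrow> real" and \<delta> :: real and r :: "nat \<Rightarrow> L2" and M :: "L2 set"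
  assumes l_pos: "0 < l n"
    and gap_pos: "0 < \<delta>"
    and gap: "l n + \<delta> \<le> l (Suc n)"
    and summable_inverse: "summable (\<lambda>n. 1 / l n)"
    and M_def: "M = closed_cspan (range (\<lambda>n. power_vec (l n)))"
    and r_mem: "r n \<in> M"
    and r_biorth: "biorthogonal (\<lambda>n. power_vec (l n)) r"
begin

abbreviation e :: "nat \<Rightarrow> L2" where
  "e n \<equiv> power_vec (l n)"

lemma l_nonneg: "0 \<le> l n"
  using l_pos[of n] by simp

lemma strict_mono_l: "strict_mono l"
proof -
  have "l n < l (Suc n)" for n using gap[of n] gap_pos by linarith
  then show ?thesis by (simp add: strict_mono_Suc_iff)
qed

lemma l_at_top: "filterlim l at_top sequentially"
proof (rule filterlim_at_top_mono)
  show "filterlim (\<lambda>n. \<delta> * real n) at_top sequentially"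
    using gap_pos by (intro filterlim_tendsto_pos_mult_at_top[OF tendsto_const] filterlim_real_sequentially)
  show "\<forall>\<^sub>F n in sequentially. \<delta> * real n \<le> l n"
    using gap_imp_distance[of l \<delta> 0, OF gap] l_pos[of 0] by (intro always_eventually allI) (smt (verit) diff_zero le0)
qed

lemma cinner_e_r: "cinner (e n) (r m) = (if m = n then 1 else 0)"
  using r_biorth by (simp add: biorthogonal_def)

lemma e_nonzero: "e n \<noteq> 0"
  using cinner_e_r[of n n] by auto

lemma closed_csubspace_M: "closed_csubspace M"
  by (simp add: M_def closed_csubspace_closed_cspan)

lemma subspace_M: "scaleC.subspace M"
  using closed_csubspace_M by (simp add: closed_csubspace_def)

lemma e_mem_M: "e n \<in> M"
  unfolding M_def by (rule subsetD[OF closed_cspan_superset]) simp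

text \<open>The expansion is claimed for all large \<open>n\<close>, not for one \<open>n\<close>,
  so that summands with different supports can be added in the induction and later index sets can be
  enlarged freely.\<close>

lemma span_expansion:
  assumes "p \<in> scaleC.span (range e)"
  shows "\<exists>N. \<forall>n\<ge>N. p = (\<Sum>k<n. cinner p (r k) *\<^sub>C e k)"
  using assms
proof (induction rule: scaleC.span_induct_alt)
  case (step c x y)
  then obtain N m where N: "\<And>n. n \<ge> N \<Longrightarrow> y = (\<Sum>k<n. cinner y (r k) *\<^sub>C e k)" and x: "x = e m" by auto
  show ?case
  proof (intro exI allI impI)
    fix n assume n: "n \<ge> max N (Suc m)"
    have "(\<Sum>k<n. cinner (c *\<^sub>C x + y) (r k) *\<^sub>C e k)
        = (\<Sum>k<n. if k = m then c *\<^sub>C e m else 0) + (\<Sum>k<n. cinner y (r k) *\<^sub>C e k)"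
      unfolding sum.distrib[symmetric]
      by (intro sum.cong refl) (simp add: x cinner_add_left cinner_scaleC_left cinner_e_r scaleC.scale_left_distrib)
    also have "\<dots> = c *\<^sub>C x + y" using n N[of n] by (simp add: x)
    finally show "c *\<^sub>C x + y = (\<Sum>k<n. cinner (c *\<^sub>C x + y) (r k) *\<^sub>C e k)" ..
  qed
qed auto

section \<open>Growth of the biorthogonal family\<close>

lemma cmod_coefficient_le: "cmod (cinner f (r n)) \<le> norm f * norm (r n)"
  by (rule cmod_cinner_le)

text \<open>Carries estimates known for finite combinations of powers over to their closure.\<close>

lemma le_on_M:
  assumes "continuous_on UNIV \<phi>" "continuous_on UNIV \<psi>"
    and "\<And>p. p \<in> scaleC.span (range e) \<Longrightarrow> \<phi> p \<le> (\<psi> p :: real)" and "f \<in> M"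
  shows "\<phi> f \<le> \<psi> f"
proof -
  have "closed {f. \<phi> f \<le> \<psi> f}" using assms(1,2) by (rule closed_Collect_le)
  then have "closure (scaleC.span (range e)) \<subseteq> {f. \<phi> f \<le> \<psi> f}"
    using assms(3) by (intro closure_minimal) auto
  then show ?thesis using assms(4) by (auto simp: M_def closed_cspan_def)
qed

text \<open>The coefficient estimate for finite sums extends to all of \<open>M\<close> by
  continuity. Since \<open>r n\<close> lies in \<open>M\<close>, it may be applied to
  \<open>r n\<close> itself, whose \<open>n\<close>-th coefficient is its squared norm.\<close>

lemma norm_r_le:
  assumes Q: "\<And>F. finite F \<Longrightarrow> n \<notin> F \<Longrightarrow> (\<Prod>k\<in>F. (l n + l k + 1) / \<bar>l n - l k\<bar>) \<le> Q"
  shows "norm (r n) \<le> Q * sqrt (2 * l n + 1)"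
proof -
  have Q0: "0 \<le> Q" using Q[of "{}"] by simp
  have "cmod (cinner f (r n)) * norm (e n) \<le> Q * norm f" if "f \<in> M" for f
    using _ _ _ that
  proof (rule le_on_M)
    show "continuous_on UNIV (\<lambda>f. cmod (cinner f (r n)) * norm (e n))"
      by (intro continuous_intros linear_continuous_on bounded_linear_cinner_left)
    show "continuous_on UNIV (\<lambda>f::L2. Q * norm f)" by (intro continuous_intros)
  next
    fix p assume "p \<in> scaleC.span (range e)"
    then obtain N where N: "\<And>k. k \<ge> N \<Longrightarrow> p = (\<Sum>i<k. cinner p (r i) *\<^sub>C e i)"
      using span_expansion by blast
    \<comment> \<open>Enlarged beyond \<open>N\<close> so that \<open>n\<close> belongs to the index
      set in any case.\<close>
    define I where "I = {..<max N (Suc n)}"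
    have I: "finite I" "n \<in> I" by (auto simp: I_def)
    have p: "(\<Sum>i\<in>I. cinner p (r i) *\<^sub>C e i) = p" using N[of "max N (Suc n)"] by (simp add: I_def)
    have "cmod (cinner p (r n)) * norm (e n)
        \<le> (\<Prod>k\<in>I - {n}. (l n + l k + 1) / \<bar>l n - l k\<bar>) * norm p"
      using coefficient_le_norm_power_sum[where a = l and c = "\<lambda>i. cinner p (r i)", OF l_nonneg _ I]
        strict_mono_imp_inj_on[OF strict_mono_l, of I]
      by (simp add: p)
    also have "\<dots> \<le> Q * norm p" using I by (intro mult_right_mono Q) auto
    finally show "cmod (cinner p (r n)) * norm (e n) \<le> Q * norm p" .
  qed
  from this[OF r_mem[of n]] have "norm (r n) * (norm (r n) * norm (e n)) \<le> norm (r n) * Q"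
    by (simp add: cinner_self_eq power2_eq_square norm_mult mult_ac)
  moreover have "r n \<noteq> 0"
    using cinner_e_r[of n n] cinner_commute[of "e n" "r n"] by auto
  ultimately have *: "norm (r n) * norm (e n) \<le> Q" by simp
  have "(norm (e n))\<^sup>2 = 1 / (2 * l n + 1)"
    using l_nonneg[of n] by (simp only: Re_cinner_self[symmetric] cinner_power_vec Re_complex_of_real) simp
  then have "norm (e n) = 1 / sqrt (2 * l n + 1)"
    by (metis norm_ge_zero real_sqrt_abs2 real_sqrt_divide real_sqrt_one real_sqrt_pow2 real_sqrt_unique)
  with * show ?thesis using l_pos[of n] by (simp add: divide_le_eq)
qed

text \<open>Half of \<open>\<epsilon>\<close> pays for the Blaschke product with
  \<open>\<mu> n = l n + 1/2\<close>, the other half for the factor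
  \<open>sqrt (2 * l n + 1)\<close>.\<close>

lemma eventually_norm_r_le:
  assumes \<epsilon>: "0 < \<epsilon>"
  shows "\<forall>\<^sub>F n in sequentially. norm (r n) \<le> exp (\<epsilon> * (l n + 1/2))"
proof -
  let ?\<mu> = "\<lambda>n. l n + 1/2"
  have "summable (\<lambda>n. 1 / ?\<mu> n)"
    by (rule summable_comparison_test'[OF summable_inverse, where N = 0])
      (use l_pos in \<open>auto intro!: divide_left_mono mult_pos_pos add_pos_pos simp: abs_of_pos add_pos_pos\<close>)
  moreover have "0 < ?\<mu> n" "?\<mu> n + \<delta> \<le> ?\<mu> (Suc n)" for n using l_pos[of n] gap[of n] by auto
  ultimately have ev: "\<forall>\<^sub>F n in sequentially. \<forall>F. finite F \<longrightarrow> n \<notin> F \<longrightarrow>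
      (\<Prod>k\<in>F. (?\<mu> n + ?\<mu> k) / \<bar>?\<mu> n - ?\<mu> k\<bar>) \<le> exp (\<epsilon> / 2 * ?\<mu> n)"
    using \<epsilon> gap_pos by (intro blaschke_product_bound[where \<delta> = \<delta>]) auto
  \<comment> \<open>From this threshold on, \<open>2 * l n + 1\<close> is at most the quadratic
    Taylor term of \<open>exp (\<epsilon> * (l n + 1/2))\<close>.\<close>
  have "\<forall>\<^sub>F n in sequentially. 4 / \<epsilon>\<^sup>2 \<le> l n"
    using l_at_top by (simp add: filterlim_at_top)
  with ev show ?thesis
  proof eventually_elim
    case (elim n)
    have "norm (r n) \<le> exp (\<epsilon> / 2 * ?\<mu> n) * sqrt (2 * l n + 1)"
      using elim(1) by (intro norm_r_le) (simp add: add_ac)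
    also have "\<dots> \<le> exp (\<epsilon> / 2 * ?\<mu> n) * exp (\<epsilon> / 2 * ?\<mu> n)"
    proof (intro mult_left_mono real_le_lsqrt)
      have "4 \<le> ?\<mu> n * \<epsilon>\<^sup>2" using elim(2) \<epsilon> zero_le_power2[of \<epsilon>]
        by (simp add: divide_le_eq algebra_simps add_increasing2)
      then have le: "?\<mu> n * 4 \<le> ?\<mu> n * (?\<mu> n * \<epsilon>\<^sup>2)"
        using l_pos[of n] by (intro mult_left_mono) auto
      have "2 * l n + 1 = ?\<mu> n * 4 / 2" by simp
      also have "\<dots> \<le> ?\<mu> n * (?\<mu> n * \<epsilon>\<^sup>2) / 2"
        using le by (rule divide_right_mono) simp
      also have "\<dots> = (\<epsilon> * ?\<mu> n)\<^sup>2 / 2"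
        by (simp only: power_mult_distrib power2_eq_square[of "?\<mu> n"] mult_ac)
      also have "\<dots> \<le> 1 + \<epsilon> * ?\<mu> n + (\<epsilon> * ?\<mu> n)\<^sup>2 / 2"
        using l_pos[of n] \<epsilon> by (intro add_increasing) auto
      also have "\<dots> \<le> exp (\<epsilon> * ?\<mu> n)"
        using l_pos[of n] \<epsilon> by (intro exp_lower_Taylor_quadratic) auto
      also have "\<dots> = (exp (\<epsilon> / 2 * ?\<mu> n))\<^sup>2"
        by (simp add: power2_eq_square exp_add[symmetric])
      finally show "2 * l n + 1 \<le> (exp (\<epsilon> / 2 * ?\<mu> n))\<^sup>2" .
    qed auto
    also have "\<dots> = exp (\<epsilon> * ?\<mu> n)" by (simp add: exp_add[symmetric])
    finally show ?case .
  qed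
qed

text \<open>Half of the decay rate \<open>- ln s\<close> absorbs the growth of
  \<open>norm (r n)\<close>; the exponential decay that is left is dominated by a multiple of
  \<open>1 / l n\<close>.\<close>

lemma summable_norm_r:
  assumes s: "0 < s" "s < 1"
  shows "summable (\<lambda>n. norm (r n) * s powr l n)"
proof -
  define \<sigma> where "\<sigma> = - ln s"
  have \<sigma>: "0 < \<sigma>" using s by (simp add: \<sigma>_def)
  have "\<forall>\<^sub>F n in sequentially. norm (norm (r n) * s powr l n) \<le> exp (\<sigma> / 4) * (2 / \<sigma>) * (1 / l n)"
  proof (rule eventually_mono[OF eventually_norm_r_le])
    show "0 < \<sigma> / 2" using \<sigma> by simp
    fix n assume n: "norm (r n) \<le> exp (\<sigma> / 2 * (l n + 1/2))"
    have "s powr l n = exp (- \<sigma> * l n)" using s by (simp add: powr_def \<sigma>_def mult.commute)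
    then have "norm (r n) * s powr l n \<le> exp (\<sigma> / 2 * (l n + 1/2)) * exp (- \<sigma> * l n)"
      using n by (simp only: mult_right_mono exp_ge_zero)
    also have "\<dots> = exp (\<sigma> / 4) * exp (- (\<sigma> / 2 * l n))"
      by (simp add: exp_add[symmetric] algebra_simps)
    also have "exp (- (\<sigma> / 2 * l n)) \<le> 2 / \<sigma> * (1 / l n)"
    proof -
      have "\<sigma> / 2 * l n \<le> exp (\<sigma> / 2 * l n)"
        using exp_ge_add_one_self[of "\<sigma> / 2 * l n"] by linarith
      moreover have "0 < \<sigma> / 2 * l n" using \<sigma> l_pos[of n] by simp
      ultimately have "inverse (exp (\<sigma> / 2 * l n)) \<le> inverse (\<sigma> / 2 * l n)"
        by (rule le_imp_inverse_le)
      then show ?thesis by (simp add: exp_minus inverse_eq_divide)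
    qed
    finally show "norm (norm (r n) * s powr l n) \<le> exp (\<sigma> / 4) * (2 / \<sigma>) * (1 / l n)"
      by (simp add: mult_ac)
  qed
  moreover have "summable (\<lambda>n. exp (\<sigma> / 4) * (2 / \<sigma>) * (1 / l n))"
    by (rule summable_mult[OF summable_inverse])
  ultimately show ?thesis by (rule summable_comparison_test_ev)
qed

section \<open>Weighted expansions and Abel means\<close>

definition abel_mean :: "real \<Rightarrow> L2 \<Rightarrow> L2" where
  "abel_mean s f = (\<Sum>n. (cinner f (r n) * of_real (s powr (l n + 1/2))) *\<^sub>C e n)"

lemma norm_expansion_term_le: "norm ((cinner f (r n) * z) *\<^sub>C e n) \<le> norm f * (norm (r n) * cmod z)"
proof -
  have "cmod (cinner f (r n)) * cmod z * norm (e n) \<le> norm f * norm (r n) * cmod z * 1"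
    by (intro mult_mono cmod_coefficient_le norm_power_vec_le_1 l_nonneg) auto
  then show ?thesis by (simp add: norm_scaleC norm_mult mult_ac)
qed

lemma summable_norm_expansion:
  assumes "summable (\<lambda>n. norm (r n) * cmod (c n))"
  shows "summable (\<lambda>n. cmod (cinner f (r n) * c n))"
proof (rule summable_comparison_test')
  show "summable (\<lambda>n. norm f * (norm (r n) * cmod (c n)))" by (rule summable_mult[OF assms])
  show "norm (cmod (cinner f (r n) * c n)) \<le> norm f * (norm (r n) * cmod (c n))" if "0 \<le> n" for n
    using mult_right_mono[OF cmod_coefficient_le[of f n], of "cmod (c n)"] by (simp add: norm_mult mult_ac)
qed

text \<open>Serves twice: with \<open>c n\<close> a power of \<open>s\<close> for the Abel means,
  and with \<open>c = u\<close> for \<open>T\<close>.\<close>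

lemma bounded_linear_expansion:
  assumes "summable (\<lambda>n. norm (r n) * cmod (c n))"
  shows "bounded_linear (\<lambda>f. \<Sum>n. (cinner f (r n) * c n) *\<^sub>C e n)"
proof (rule bounded_linear_intro)
  note summ = power_series_summable_L2[OF summable_norm_expansion[OF assms] l_nonneg]
  fix f g :: L2 and x :: real
  show "(\<Sum>n. (cinner (f + g) (r n) * c n) *\<^sub>C e n)
      = (\<Sum>n. (cinner f (r n) * c n) *\<^sub>C e n) + (\<Sum>n. (cinner g (r n) * c n) *\<^sub>C e n)"
    by (subst suminf_add[OF summ summ]) (simp add: cinner_add_left distrib_right scaleC.scale_left_distrib)
  show "(\<Sum>n. (cinner (x *\<^sub>R f) (r n) * c n) *\<^sub>C e n) = x *\<^sub>R (\<Sum>n. (cinner f (r n) * c n) *\<^sub>C e n)"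
    by (subst suminf_scaleR_right[OF summ]) (simp add: scaleR_scaleC cinner_scaleC_left mult.assoc)
  have "summable (\<lambda>n. norm ((cinner f (r n) * c n) *\<^sub>C e n))"
    by (rule summable_comparison_test'[OF summable_mult[OF assms, of "norm f"], where N = 0])
      (simp add: norm_expansion_term_le)
  then have "norm (\<Sum>n. (cinner f (r n) * c n) *\<^sub>C e n) \<le> (\<Sum>n. norm f * (norm (r n) * cmod (c n)))"
    by (intro order_trans[OF summable_norm] suminf_le norm_expansion_term_le summable_mult assms)
  then show "norm (\<Sum>n. (cinner f (r n) * c n) *\<^sub>C e n) \<le> norm f * (\<Sum>n. norm (r n) * cmod (c n))"
    by (simp only: suminf_mult[OF assms])
qed

lemma summable_norm_r_abel:
  assumes "0 < s" "s < 1"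
  shows "summable (\<lambda>n. norm (r n) * cmod (of_real (s powr (l n + 1/2))))"
proof -
  have "norm (r n) * cmod (of_real (s powr (l n + 1/2))) = s powr (1/2) * (norm (r n) * s powr l n)" for n
    unfolding powr_add norm_of_real by (simp add: abs_mult)
  then show ?thesis
    using summable_mult[OF summable_norm_r[OF assms], of "s powr (1/2)"] by (simp only:)
qed

lemma bounded_linear_abel_mean: "0 < s \<Longrightarrow> s < 1 \<Longrightarrow> bounded_linear (abel_mean s)"
  unfolding abel_mean_def[abs_def] by (intro bounded_linear_expansion summable_norm_r_abel)

text \<open>By biorthogonality the coefficients from \<open>N\<close> on vanish, so the series is a
  finite sum, with the same \<open>N\<close> for all \<open>s\<close>.\<close>

lemma abel_mean_span:
  assumes "p \<in> scaleC.span (range e)"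
  obtains N where "p = (\<Sum>k<N. cinner p (r k) *\<^sub>C e k)"
    and "\<And>s. abel_mean s p = (\<Sum>k<N. (cinner p (r k) * of_real (s powr (l k + 1/2))) *\<^sub>C e k)"
proof -
  obtain N where N: "\<And>n. n \<ge> N \<Longrightarrow> p = (\<Sum>k<n. cinner p (r k) *\<^sub>C e k)"
    using span_expansion[OF assms] by blast
  have "cinner p (r k) = 0" if "k \<ge> N" for k
  proof -
    have "cinner p (r k) = cinner (\<Sum>i<N. cinner p (r i) *\<^sub>C e i) (r k)" using N[of N] by simp
    also have "\<dots> = 0"
      using that by (auto simp: cinner_sum_left cinner_scaleC_left cinner_e_r intro!: sum.neutral)
    finally show ?thesis .
  qed
  then have "abel_mean s p = (\<Sum>k<N. (cinner p (r k) * of_real (s powr (l k + 1/2))) *\<^sub>C e k)" for s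
    unfolding abel_mean_def by (intro suminf_finite) auto
  with N[of N] show ?thesis by (intro that[of N]) auto
qed

text \<open>Provides a bound uniform in \<open>s\<close>, whereas the one from absolute convergence
  depends on \<open>s\<close>. The 1/2 in the exponent is the factor \<open>sqrt s\<close> that
  makes the dilation a contraction.\<close>

lemma norm_abel_mean_le:
  assumes s: "0 < s" "s < 1" and f: "f \<in> M"
  shows "norm (abel_mean s f) \<le> norm f"
  using _ _ _ f
proof (rule le_on_M)
  show "continuous_on UNIV (\<lambda>f. norm (abel_mean s f))"
    by (intro continuous_intros linear_continuous_on bounded_linear_abel_mean s)
  show "continuous_on UNIV (\<lambda>f::L2. norm f)" by (intro continuous_intros)
next
  fix p assume "p \<in> scaleC.span (range e)"
  then obtain N where p: "p = (\<Sum>k<N. cinner p (r k) *\<^sub>C e k)"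
    and a: "\<And>s. abel_mean s p = (\<Sum>k<N. (cinner p (r k) * of_real (s powr (l k + 1/2))) *\<^sub>C e k)"
    by (rule abel_mean_span) (rule that)
  have "norm (abel_mean s p) \<le> norm (\<Sum>k<N. cinner p (r k) *\<^sub>C e k)"
    unfolding a using s by (intro norm_dilation_multiplier_le l_nonneg) auto
  then show "norm (abel_mean s p) \<le> norm p" by (simp only: p[symmetric])
qed

lemma abel_mean_tendsto_span:
  assumes "p \<in> scaleC.span (range e)"
  shows "((\<lambda>s. abel_mean s p) \<longlongrightarrow> p) (at_left 1)"
proof -
  obtain N where p: "p = (\<Sum>k<N. cinner p (r k) *\<^sub>C e k)"
    and a: "\<And>s. abel_mean s p = (\<Sum>k<N. (cinner p (r k) * of_real (s powr (l k + 1/2))) *\<^sub>C e k)"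
    by (rule abel_mean_span[OF assms]) (rule that)
  have "((\<lambda>s. \<Sum>k<N. (cinner p (r k) * of_real (s powr (l k + 1/2))) *\<^sub>C e k)
      \<longlongrightarrow> (\<Sum>k<N. (cinner p (r k) * of_real (1 powr (l k + 1/2))) *\<^sub>C e k)) (at_left 1)"
    by (intro tendsto_intros bounded_linear.tendsto[OF bounded_linear_scaleC_left]) auto
  then show ?thesis by (simp add: a p[symmetric])
qed

text \<open>Convergence is clear on the dense span; the uniform contraction bound extends it to
  \<open>M\<close> by splitting the error in three.\<close>

lemma abel_mean_tendsto:
  assumes f: "f \<in> M"
  shows "((\<lambda>s. abel_mean s f) \<longlongrightarrow> f) (at_left 1)"
proof (rule tendstoI)
  fix \<epsilon> :: real assume \<epsilon>: "0 < \<epsilon>"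
  obtain p where p: "p \<in> scaleC.span (range e)" and fp: "norm (p - f) < \<epsilon> / 3"
    using f \<epsilon> unfolding M_def closed_cspan_def closure_approachable dist_norm
    by (meson divide_pos_pos zero_less_numeral)
  have pM: "p \<in> M" using p closure_subset by (auto simp: M_def closed_cspan_def)
  have "\<forall>\<^sub>F s in at_left 1. dist (abel_mean s p) p < \<epsilon> / 3"
    using \<epsilon> by (intro tendstoD[OF abel_mean_tendsto_span[OF p]]) simp
  moreover have "\<forall>\<^sub>F s in at_left 1. s \<in> {0<..<1::real}"
    by (rule eventually_at_left_real) simp
  ultimately show "\<forall>\<^sub>F s in at_left 1. dist (abel_mean s f) f < \<epsilon>"
  proof eventually_elim
    case (elim s)
    have "norm (abel_mean s (p - f)) \<le> norm (p - f)"
      using elim pM f by (intro norm_abel_mean_le scaleC.subspace_diff[OF subspace_M]) auto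
    moreover have "abel_mean s (p - f) = abel_mean s p - abel_mean s f"
      using elim by (intro linear_diff bounded_linear.linear bounded_linear_abel_mean) auto
    moreover have "abel_mean s f - f = (abel_mean s p - p) - (abel_mean s p - abel_mean s f) + (p - f)"
      by simp
    ultimately have "norm (abel_mean s f - f) \<le> norm (abel_mean s p - p) + norm (p - f) + norm (p - f)"
      by (smt (verit) norm_triangle_ineq norm_triangle_ineq4)
    then show ?case using elim fp by (simp add: dist_norm)
  qed
qed

text \<open>Every Abel mean is a convergent series using only powers whose coefficient in
  \<open>f\<close> is nonzero, and \<open>f\<close> is the limit of its Abel means.\<close>

lemma mem_closed_cspan_support:
  assumes f: "f \<in> M"
  shows "f \<in> closed_cspan (e ` {n. cinner f (r n) \<noteq> 0})" (is "f \<in> ?S")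
proof (rule Lim_in_closed_set)
  show "closed ?S" by (simp add: closed_cspan_def)
  show "((\<lambda>s. abel_mean s f) \<longlongrightarrow> f) (at_left 1)" by (rule abel_mean_tendsto[OF f])
  show "at_left (1::real) \<noteq> bot" by simp
  have S: "scaleC.subspace ?S"
    using closed_csubspace_closed_cspan by (simp add: closed_csubspace_def)
  have summand: "(cinner f (r n) * c) *\<^sub>C e n \<in> ?S" for n c
  proof (cases "cinner f (r n) = 0")
    case True
    then show ?thesis using scaleC.subspace_0[OF S] by simp
  next
    case False
    then have "e n \<in> ?S" by (intro subsetD[OF closed_cspan_superset] imageI) simp
    then show ?thesis by (rule scaleC.subspace_scale[OF S])
  qed
  have "\<forall>\<^sub>F s in at_left 1. s \<in> {0<..<1::real}"
    by (rule eventually_at_left_real) simp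
  then show "\<forall>\<^sub>F s in at_left 1. abel_mean s f \<in> ?S"
  proof eventually_elim
    case (elim s)
    then have "summable (\<lambda>n. (cinner f (r n) * of_real (s powr (l n + 1/2))) *\<^sub>C e n)"
      using power_series_summable_L2[where a = l, OF summable_norm_expansion[OF summable_norm_r_abel] l_nonneg]
      by simp
    then show ?case
      unfolding abel_mean_def by (rule closed_csubspace_suminf[OF closed_csubspace_closed_cspan summand])
  qed
qed

end

section \<open>The diagonal operator\<close>

locale muntz_operator = muntz_system +
  fixes u :: "nat \<Rightarrow> complex" and \<rho> :: real and T :: "L2 \<Rightarrow> L2"
  assumes u_inj: "inj u"
    and u_nonzero: "u n \<noteq> 0"
    and rho: "0 < \<rho>" "\<rho> < 1"
    and u_bound: "cmod (u n) \<le> \<rho> powr l n"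
    and T_def: "f \<in> M \<Longrightarrow> T f = abs_L2 (\<lambda>x. \<Sum>n. cinner f (r n) * u n * power_fun (l n) x)"
begin

section \<open>Boundedness and diagonal action of \<open>T\<close>\<close>

lemma summable_norm_r_u: "summable (\<lambda>n. norm (r n) * cmod (u n))"
  by (rule summable_comparison_test'[OF summable_norm_r[OF rho], where N = 0])
    (simp add: mult_left_mono u_bound)

lemma summable_T: "summable (\<lambda>n. (cinner f (r n) * u n) *\<^sub>C e n)"
  by (intro power_series_summable_L2 summable_norm_expansion summable_norm_r_u l_nonneg)

lemma T_eq: "f \<in> M \<Longrightarrow> T f = (\<Sum>n. (cinner f (r n) * u n) *\<^sub>C e n)"
  unfolding T_def
  by (intro abs_L2_power_series summable_norm_expansion summable_norm_r_u l_nonneg)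

lemma T_mem_M:
  assumes f: "f \<in> M"
  shows "T f \<in> M"
  unfolding T_eq[OF f]
  by (intro closed_csubspace_suminf closed_csubspace_M scaleC.subspace_scale[OF subspace_M] e_mem_M summable_T)

lemma T_add:
  assumes "f \<in> M" "g \<in> M"
  shows "T (f + g) = T f + T g"
  using linear_add[OF bounded_linear.linear[OF bounded_linear_expansion[OF summable_norm_r_u]], of f g]
  by (simp add: T_eq assms scaleC.subspace_add[OF subspace_M])

lemma T_scaleC:
  assumes "f \<in> M"
  shows "T (c *\<^sub>C f) = c *\<^sub>C T f"
  using bounded_linear.suminf[OF bounded_linear_scaleC_right summable_T, of c f]
  by (simp add: T_eq assms scaleC.subspace_scale[OF subspace_M] cinner_scaleC_left mult.assoc)

lemma T_diff:
  assumes "f \<in> M" "g \<in> M"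
  shows "T (f - g) = T f - T g"
  using T_add[OF scaleC.subspace_diff[OF subspace_M assms] assms(2)] by simp

lemma T_coefficient:
  assumes f: "f \<in> M"
  shows "cinner (T f) (r m) = cinner f (r m) * u m"
proof -
  have "cinner (T f) (r m) = (\<Sum>n. cinner ((cinner f (r n) * u n) *\<^sub>C e n) (r m))"
    unfolding T_eq[OF f] by (rule bounded_linear.suminf[OF bounded_linear_cinner_left summable_T])
  also have "\<dots> = (\<Sum>n\<in>{m}. cinner ((cinner f (r n) * u n) *\<^sub>C e n) (r m))"
    by (intro suminf_finite) (auto simp: cinner_scaleC_left cinner_e_r)
  finally show ?thesis by (simp add: cinner_scaleC_left cinner_e_r)
qed

text \<open>If all coefficients of \<open>f - g\<close> vanish, its support is empty, so it lies in
  the closed span of the empty set.\<close>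

lemma M_eqI:
  assumes "f \<in> M" "g \<in> M" "\<And>n. cinner f (r n) = cinner g (r n)"
  shows "f = g"
proof -
  have "f - g \<in> M" using assms(1,2) by (rule scaleC.subspace_diff[OF subspace_M])
  from mem_closed_cspan_support[OF this] have "f - g \<in> closed_cspan {}"
    using assms(3) by (simp add: cinner_diff_left)
  then show ?thesis by (simp add: closed_cspan_def)
qed

lemma T_e: "T (e n) = u n *\<^sub>C e n"
  by (rule M_eqI)
    (auto simp: T_mem_M e_mem_M scaleC.subspace_scale[OF subspace_M] T_coefficient cinner_scaleC_left cinner_e_r)

lemma T_bounded_operator: "bounded_operator_on M T"
proof -
  obtain K where "\<And>f. norm (\<Sum>n. (cinner f (r n) * u n) *\<^sub>C e n) \<le> norm f * K"
    using bounded_linear.bounded[OF bounded_linear_expansion[OF summable_norm_r_u]] by blast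
  then have "\<forall>f\<in>M. norm (T f) \<le> K * norm f" by (simp add: T_eq mult.commute)
  then show ?thesis
    by (auto simp: bounded_operator_on_def linear_operator_on_def T_mem_M T_add T_scaleC)
qed

section \<open>Failure of normality\<close>

lemma M_orthogonal_eq_0:
  assumes "d \<in> M" "\<And>f. f \<in> M \<Longrightarrow> cinner f d = 0"
  shows "d = 0"
  using assms(2)[OF assms(1)] by (simp add: cinner_self_eq)

text \<open>
  A normal \<open>T\<close> commutes with its adjoint \<open>S\<close>, so \<open>S\<close> preserves the one-dimensional eigenspaces of
  \<open>T\<close>; since \<open>cinner (e m) (e 0) \<noteq> 0\<close> for all \<open>m\<close>, all eigenvalues of \<open>T\<close> would coincide.
\<close>

lemma T_not_normal: "\<not> normal_operator_on M T"
proof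
  assume "normal_operator_on M T"
  then obtain S where SM: "\<And>f. f \<in> M \<Longrightarrow> S f \<in> M"
    and adj: "\<And>f g. f \<in> M \<Longrightarrow> g \<in> M \<Longrightarrow> cinner (T f) g = cinner f (S g)"
    and comm: "\<And>f. f \<in> M \<Longrightarrow> T (S f) = S (T f)"
    unfolding normal_operator_on_def adjoint_on_def by (metis Pi_mem)
  \<comment> \<open>\<open>S\<close> is given only through the adjoint relation; its homogeneity at
    \<open>e 0\<close> follows because both vectors pair equally with all of
    \<open>M\<close>.\<close>
  have "S (u 0 *\<^sub>C e 0) - u 0 *\<^sub>C S (e 0) = 0"
  proof (rule M_orthogonal_eq_0)
    show "S (u 0 *\<^sub>C e 0) - u 0 *\<^sub>C S (e 0) \<in> M"
      by (intro scaleC.subspace_diff[OF subspace_M] scaleC.subspace_scale[OF subspace_M] SM e_mem_M)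
    show "cinner f (S (u 0 *\<^sub>C e 0) - u 0 *\<^sub>C S (e 0)) = 0" if "f \<in> M" for f
      using that
      by (simp add: cinner_diff_right cinner_scaleC_right adj[symmetric] e_mem_M scaleC.subspace_scale[OF subspace_M])
  qed
  then have TS: "T (S (e 0)) = u 0 *\<^sub>C S (e 0)"
    by (simp add: comm[OF e_mem_M] T_e)
  define c where "c = cinner (S (e 0)) (r 0)"
  \<comment> \<open>The coefficients at \<open>k \<noteq> 0\<close> vanish since the eigenvalues
    \<open>u k\<close> and \<open>u 0\<close> differ.\<close>
  have S0: "S (e 0) = c *\<^sub>C e 0"
  proof (rule M_eqI)
    fix k
    have "cinner (S (e 0)) (r k) * u k = u 0 * cinner (S (e 0)) (r k)"
      using T_coefficient[OF SM[OF e_mem_M], of 0 k] unfolding TS cinner_scaleC_left by (rule sym)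
    then have "cinner (S (e 0)) (r k) = 0 \<or> u k = u 0" by auto
    then show "cinner (S (e 0)) (r k) = cinner (c *\<^sub>C e 0) (r k)"
      using injD[OF u_inj, of k 0] by (auto simp: c_def cinner_scaleC_left cinner_e_r)
  qed (auto simp: SM e_mem_M scaleC.subspace_scale[OF subspace_M])
  have "u m = cnj c" for m
  proof -
    have "l m + l 0 + 1 \<noteq> 0" using l_pos[of m] l_pos[of 0] by linarith
    then have "cinner (e m) (e 0) \<noteq> 0"
      by (simp only: cinner_power_vec[OF l_nonneg l_nonneg] of_real_eq_0_iff) simp
    moreover have "u m * cinner (e m) (e 0) = cnj c * cinner (e m) (e 0)"
      using adj[OF e_mem_M e_mem_M, of m 0] by (simp only: T_e S0 cinner_scaleC_left cinner_scaleC_right)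
    ultimately show ?thesis by simp
  qed
  then have "u 0 = u 1" by metis
  then show False using injD[OF u_inj, of 0 1] by simp
qed

section \<open>Compactness\<close>

lemma compact_coefficient_box:
  fixes w :: "nat \<Rightarrow> real"
  shows "\<exists>K. compact K \<and> (\<forall>c. (\<forall>k<N. cmod (c k) \<le> w k) \<longrightarrow> (\<Sum>k<N. c k *\<^sub>C e k) \<in> K)"
proof (induction N)
  case 0
  show ?case by (intro exI[of _ "{0}"]) simp
next
  case (Suc N)
  then obtain K where K: "compact K" "\<And>c. (\<And>k. k < N \<Longrightarrow> cmod (c k) \<le> w k) \<Longrightarrow> (\<Sum>k<N. c k *\<^sub>C e k) \<in> K"
    by blast
  \<comment> \<open>The new coefficient ranges over a compact disc; the box for \<open>Suc N\<close>
    is the Minkowski sum of its image with the previous compact set.\<close>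
  have "compact ((\<lambda>z. z *\<^sub>C e N) ` cball 0 (w N))"
    by (intro compact_continuous_image linear_continuous_on bounded_linear_scaleC_left compact_cball)
  then have "compact {x + y |x y. x \<in> K \<and> y \<in> (\<lambda>z. z *\<^sub>C e N) ` cball 0 (w N)}"
    by (rule compact_sums[OF K(1)])
  moreover have "(\<Sum>k<Suc N. c k *\<^sub>C e k) \<in> {x + y |x y. x \<in> K \<and> y \<in> (\<lambda>z. z *\<^sub>C e N) ` cball 0 (w N)}"
    if "\<And>k. k < Suc N \<Longrightarrow> cmod (c k) \<le> w k" for c
  proof -
    have "(\<Sum>k<N. c k *\<^sub>C e k) \<in> K" using that by (intro K(2)) simp
    moreover have "c N *\<^sub>C e N \<in> (\<lambda>z. z *\<^sub>C e N) ` cball 0 (w N)"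
      using that[of N] by (intro imageI) simp
    ultimately show ?thesis unfolding sum.lessThan_Suc by blast
  qed
  ultimately show ?case by blast
qed

text \<open>The error is uniform on bounded sets, so \<open>T\<close> is a norm limit of finite-rank
  truncations.\<close>

lemma T_tail_le:
  assumes "f \<in> M"
  shows "norm (T f - (\<Sum>k<N. (cinner f (r k) * u k) *\<^sub>C e k))
    \<le> norm f * (\<Sum>k. norm (r (k + N)) * cmod (u (k + N)))"
proof -
  note summable_tail = summable_ignore_initial_segment[OF summable_norm_r_u, of N]
  have sn: "summable (\<lambda>k. norm ((cinner f (r (k + N)) * u (k + N)) *\<^sub>C e (k + N)))"
    by (rule summable_comparison_test'[OF summable_mult[OF summable_tail, of "norm f"], where N = 0])
      (simp add: norm_expansion_term_le)
  have "T f - (\<Sum>k<N. (cinner f (r k) * u k) *\<^sub>C e k)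
      = (\<Sum>k. (cinner f (r (k + N)) * u (k + N)) *\<^sub>C e (k + N))"
    unfolding T_eq[OF assms] by (rule suminf_minus_initial_segment[OF summable_T, symmetric])
  also have "norm \<dots> \<le> (\<Sum>k. norm f * (norm (r (k + N)) * cmod (u (k + N))))"
    by (rule order_trans[OF summable_norm[OF sn] suminf_le[OF norm_expansion_term_le sn summable_mult[OF summable_tail]]])
  finally show ?thesis by (simp only: suminf_mult[OF summable_tail])
qed

lemma T_compact: "compact_operator_on M T"
  unfolding compact_operator_on_def
proof (intro conjI allI impI)
  show "linear_operator_on M T" using T_bounded_operator by (simp add: bounded_operator_on_def)
  fix B assume BM: "B \<subseteq> M" and "bounded B"
  then obtain R where R: "0 < R" "\<And>f. f \<in> B \<Longrightarrow> norm f \<le> R" by (auto simp: bounded_pos)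
  show "compact (closure (T ` B))"
    unfolding compact_eq_totally_bounded
  proof (intro conjI allI impI)
    show "complete (closure (T ` B))" by (simp add: complete_eq_closed)
    fix \<epsilon> :: real assume \<epsilon>: "0 < \<epsilon>"
    then have "0 < \<epsilon> / (3 * R)" using R(1) by simp
    from suminf_exist_split[OF this summable_norm_r_u]
    obtain N where N: "(\<Sum>k. norm (r (k + N)) * cmod (u (k + N))) < \<epsilon> / (3 * R)"
      by (auto dest!: spec[of _ "_ :: nat"] simp: abs_less_iff)
    obtain K where K: "compact K"
      "\<And>c. (\<And>k. k < N \<Longrightarrow> cmod (c k) \<le> R * (norm (r k) * cmod (u k))) \<Longrightarrow> (\<Sum>k<N. c k *\<^sub>C e k) \<in> K"
      using compact_coefficient_box[of N "\<lambda>k. R * (norm (r k) * cmod (u k))"] by auto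
    obtain X where X: "finite X" "K \<subseteq> (\<Union>x\<in>X. ball x (\<epsilon> / 3))"
      using K(1) \<epsilon> unfolding compact_eq_totally_bounded by (meson divide_pos_pos zero_less_numeral)
    \<comment> \<open>One third of \<open>\<epsilon>\<close> comes from the finite net of the
      truncations, one third from the tail. Closed balls are used so that the cover survives taking
      the closure.\<close>
    have "T ` B \<subseteq> (\<Union>x\<in>X. cball x (2 * \<epsilon> / 3))"
    proof (rule image_subsetI)
      fix f assume f: "f \<in> B"
      define P where "P = (\<Sum>k<N. (cinner f (r k) * u k) *\<^sub>C e k)"
      have "P \<in> K" unfolding P_def
      proof (rule K(2))
        fix k
        have "cmod (cinner f (r k)) * cmod (u k) \<le> (R * norm (r k)) * cmod (u k)"
          using R f by (intro mult_right_mono order_trans[OF cmod_coefficient_le]) auto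
        then show "cmod (cinner f (r k) * u k) \<le> R * (norm (r k) * cmod (u k))"
          by (simp add: norm_mult mult.assoc)
      qed
      then obtain x where x: "x \<in> X" "dist x P < \<epsilon> / 3" using X(2) by auto
      have "norm (T f - P) \<le> R * (\<epsilon> / (3 * R))"
        unfolding P_def using f BM R N
        by (intro order_trans[OF T_tail_le] mult_mono suminf_nonneg
            summable_ignore_initial_segment[OF summable_norm_r_u]) auto
      also have "\<dots> = \<epsilon> / 3" using R(1) by simp
      finally have "dist P (T f) \<le> \<epsilon> / 3" by (simp add: dist_norm norm_minus_commute)
      then have "dist x (T f) \<le> 2 * \<epsilon> / 3" using x(2) dist_triangle[of x "T f" P] by linarith
      then show "T f \<in> (\<Union>x\<in>X. cball x (2 * \<epsilon> / 3))" using x(1) by auto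
    qed
    then have "closure (T ` B) \<subseteq> (\<Union>x\<in>X. cball x (2 * \<epsilon> / 3))"
      using X(1) by (intro closure_minimal closed_UN) auto
    also have "\<dots> \<subseteq> (\<Union>x\<in>X. ball x \<epsilon>)" using \<epsilon> by (intro UN_mono) auto
    finally show "\<exists>k. finite k \<and> closure (T ` B) \<subseteq> (\<Union>x\<in>k. ball x \<epsilon>)" using X(1) by blast
  qed
qed

section \<open>Invariant subspaces and spectral synthesis\<close>

lemma u_tendsto_0: "u \<longlonglongrightarrow> 0"
proof (rule Lim_null_comparison[OF always_eventually summable_LIMSEQ_zero[OF summable_norm_r_u]], rule allI)
  fix n
  \<comment> \<open>As \<open>norm (e n)\<close> is at most 1, biorthogonality forces
    \<open>norm (r n) \<ge> 1\<close>, so \<open>cmod (u n)\<close> is below a summable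
    term.\<close>
  have "1 \<le> norm (e n) * norm (r n)" using cmod_cinner_le[of "e n" "r n"] by (simp add: cinner_e_r)
  also have "\<dots> \<le> 1 * norm (r n)" by (intro mult_right_mono norm_power_vec_le_1 l_nonneg) simp
  finally show "cmod (u n) \<le> norm (r n) * cmod (u n)"
    using mult_right_mono[of 1 "norm (r n)" "cmod (u n)"] by simp
qed

text \<open>
  Multiplying by \<open>T - u i\<close> for the finitely many \<open>i \<noteq> m\<close> with \<open>cmod (u i) > cmod (u m) / 2\<close> removes
  the coefficients at these \<open>i\<close>; normalized powers of \<open>T\<close> then converge to the \<open>m\<close>-th term.
\<close>

lemma e_mem_invariant_subspace:
  assumes A: "closed_csubspace A" "A \<subseteq> M" "T ` A \<subseteq> A"
    and f: "f \<in> A" "cinner f (r m) \<noteq> 0"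
  shows "e m \<in> A"
proof -
  have sub: "scaleC.subspace A" and cl: "closed A" using A(1) by (auto simp: closed_csubspace_def)
  have AM: "h \<in> M" if "h \<in> A" for h using A(2) that by auto
  have TA: "T h \<in> A" if "h \<in> A" for h using A(3) that by auto
  define F where "F = {n. n \<noteq> m \<and> cmod (u m) / 2 < cmod (u n)}"
  have "\<forall>\<^sub>F n in sequentially. cmod (u n) < cmod (u m) / 2"
    using tendsto_norm[OF u_tendsto_0] u_nonzero[of m] by (intro order_tendstoD(2)) auto
  then obtain n0 where "\<And>n. n \<ge> n0 \<Longrightarrow> cmod (u n) < cmod (u m) / 2"
    by (auto simp: eventually_sequentially)
  then have "F \<subseteq> {..<n0}" by (auto simp: F_def not_le[symmetric] intro: less_imp_le)
  then have F: "finite F" by (rule finite_subset) simp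
  have "\<exists>g\<in>A. \<forall>n. cinner g (r n) = (\<Prod>i\<in>F. u n - u i) * cinner f (r n)"
    using F
  proof (induction F)
    case empty
    then show ?case using f(1) by auto
  next
    case (insert i F)
    then obtain g where g: "g \<in> A" "\<And>n. cinner g (r n) = (\<Prod>i\<in>F. u n - u i) * cinner f (r n)" by auto
    show ?case
    proof (intro bexI allI)
      show "T g - u i *\<^sub>C g \<in> A"
        by (intro scaleC.subspace_diff[OF sub] scaleC.subspace_scale[OF sub] TA g(1))
      show "cinner (T g - u i *\<^sub>C g) (r n) = (\<Prod>i\<in>insert i F. u n - u i) * cinner f (r n)" for n
        using insert.hyps
        by (simp add: cinner_diff_left cinner_scaleC_left T_coefficient AM[OF g(1)] g(2) algebra_simps)
    qed
  qed
  then obtain g where gA: "g \<in> A" and g: "\<And>n. cinner g (r n) = (\<Prod>i\<in>F. u n - u i) * cinner f (r n)"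
    by blast
  have gF: "cinner g (r n) = 0" if "n \<in> F" for n
    using that F by (auto simp: g)
  define a where "a = cinner g (r m)"
  have "u m \<noteq> u i" if "i \<in> F" for i using injD[OF u_inj, of m i] that by (auto simp: F_def)
  then have a: "a \<noteq> 0" using f(2) F by (simp add: a_def g)
  have "\<exists>h\<in>A. \<forall>n. cinner h (r n) = (u n / u m) ^ k * cinner g (r n)" for k
  proof (induction k)
    case 0
    then show ?case using gA by auto
  next
    case (Suc k)
    then obtain h where h: "h \<in> A" "\<And>n. cinner h (r n) = (u n / u m) ^ k * cinner g (r n)" by auto
    show ?case
    proof (intro bexI allI)
      show "(1 / u m) *\<^sub>C T h \<in> A" by (intro scaleC.subspace_scale[OF sub] TA h(1))
      show "cinner ((1 / u m) *\<^sub>C T h) (r n) = (u n / u m) ^ Suc k * cinner g (r n)" for n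
        by (simp add: cinner_scaleC_left T_coefficient AM[OF h(1)] h(2))
    qed
  qed
  then obtain h where hA: "\<And>k. h k \<in> A" and h: "\<And>k n. cinner (h k) (r n) = (u n / u m) ^ k * cinner g (r n)"
    by metis
  define C where "C = norm g * (\<Sum>n. norm (r n) * cmod (u n))"
  \<comment> \<open>The coefficients of \<open>h k\<close> converge to those of
    \<open>a *\<^sub>C e m\<close>, but this alone gives no norm control. One further application of
    \<open>T\<close> inserts the weights \<open>u n\<close>, for which the expansion converges
    absolutely.\<close>
  have bound: "norm (T (h k) - (a * u m) *\<^sub>C e m) \<le> (1/2) ^ k * C" for k
  proof -
    define d where "d = h k - a *\<^sub>C e m"
    have dM: "d \<in> M"
      unfolding d_def by (intro scaleC.subspace_diff[OF subspace_M] scaleC.subspace_scale[OF subspace_M] AM hA e_mem_M)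
    have Td: "T d = T (h k) - (a * u m) *\<^sub>C e m"
      by (simp add: d_def T_diff T_scaleC T_e AM[OF hA] e_mem_M scaleC.subspace_scale[OF subspace_M])
    have le: "norm ((cinner d (r n) * u n) *\<^sub>C e n) \<le> (1/2) ^ k * (norm g * (norm (r n) * cmod (u n)))" for n
    proof -
      \<comment> \<open>The coefficient is zero at \<open>m\<close> by the choice of
        \<open>a\<close> and on \<open>F\<close> by the construction of \<open>g\<close>; elsewhere
        \<open>u n / u m\<close> has modulus at most 1/2.\<close>
      have "norm (cinner d (r n)) \<le> (1/2) ^ k * cmod (cinner g (r n))"
      proof (cases "n = m \<or> n \<in> F")
        case True
        have "cinner d (r n) = 0"
        proof (cases "n = m")
          case True
          then show ?thesis
            using u_nonzero[of m] by (simp add: d_def cinner_diff_left cinner_scaleC_left cinner_e_r h a_def)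
        next
          case False
          then show ?thesis
            using True gF[of n] by (simp add: d_def cinner_diff_left cinner_scaleC_left cinner_e_r h)
        qed
        then show ?thesis by simp
      next
        case False
        then have "cinner d (r n) = (u n / u m) ^ k * cinner g (r n)"
          by (simp add: d_def cinner_diff_left cinner_scaleC_left cinner_e_r h)
        moreover have "cmod (u n / u m) \<le> 1/2"
          using False u_nonzero[of m] by (auto simp: F_def norm_divide divide_le_eq)
        then have "cmod (u n / u m) ^ k \<le> (1/2) ^ k" by (intro power_mono) auto
        ultimately show ?thesis by (simp only: norm_mult norm_power) (intro mult_right_mono, auto)
      qed
      then have "norm (cinner d (r n)) * (cmod (u n) * norm (e n))
          \<le> ((1/2) ^ k * cmod (cinner g (r n))) * (cmod (u n) * norm (e n))"
        by (intro mult_right_mono) auto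
      also have "\<dots> = (1/2) ^ k * norm ((cinner g (r n) * u n) *\<^sub>C e n)"
        by (simp add: norm_scaleC norm_mult)
      also have "\<dots> \<le> (1/2) ^ k * (norm g * (norm (r n) * cmod (u n)))"
        by (intro mult_left_mono norm_expansion_term_le) simp
      finally show ?thesis by (simp add: norm_scaleC norm_mult)
    qed
    note sm = summable_mult[OF summable_mult[OF summable_norm_r_u, of "norm g"], of "(1/2) ^ k"]
    have sn: "summable (\<lambda>n. norm ((cinner d (r n) * u n) *\<^sub>C e n))"
      by (rule summable_comparison_test'[OF sm, where N = 0]) (simp only: real_norm_def abs_norm_cancel le)
    have "norm (T d) \<le> (\<Sum>n. (1/2) ^ k * (norm g * (norm (r n) * cmod (u n))))"
      unfolding T_eq[OF dM] by (rule order_trans[OF summable_norm[OF sn] suminf_le[OF le sn sm]])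
    also have "\<dots> = (1/2) ^ k * C"
      unfolding C_def by (simp only: suminf_mult[OF summable_mult[OF summable_norm_r_u]] suminf_mult[OF summable_norm_r_u])
    finally show ?thesis by (simp only: Td)
  qed
  have "(\<lambda>k. (1/2) ^ k * C) \<longlonglongrightarrow> 0 * C"
    by (intro tendsto_intros LIMSEQ_power_zero) simp
  then have "(\<lambda>k. T (h k) - (a * u m) *\<^sub>C e m) \<longlonglongrightarrow> 0"
    by (intro Lim_null_comparison[OF always_eventually[OF allI[OF bound]]]) simp
  then have "(\<lambda>k. T (h k)) \<longlonglongrightarrow> (a * u m) *\<^sub>C e m"
    by (rule LIM_zero_cancel)
  then have "(a * u m) *\<^sub>C e m \<in> A"
    by (rule closed_sequentially[OF cl TA[OF hA]])
  then have "(1 / (a * u m)) *\<^sub>C ((a * u m) *\<^sub>C e m) \<in> A"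
    by (rule scaleC.subspace_scale[OF sub])
  then show ?thesis using a u_nonzero[of m] by simp
qed

text \<open>For \<open>f\<close> in \<open>A\<close>, every \<open>e n\<close> in the support of
  \<open>f\<close> is an eigenvector lying in \<open>A\<close>, and these already recover
  \<open>f\<close> in their closed span.\<close>

lemma closed_cspan_eigenvectors:
  assumes A: "closed_csubspace A" "A \<subseteq> M" "T ` A \<subseteq> A"
  shows "closed_cspan (eigenvectors_in A T) = A"
proof
  show "closed_cspan (eigenvectors_in A T) \<subseteq> A"
    by (rule closed_cspan_least[OF _ A(1)]) (auto simp: eigenvectors_in_def)
  show "A \<subseteq> closed_cspan (eigenvectors_in A T)"
  proof
    fix f assume f: "f \<in> A"
    have "e ` {n. cinner f (r n) \<noteq> 0} \<subseteq> eigenvectors_in A T"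
      using e_mem_invariant_subspace[OF A f] e_nonzero T_e unfolding eigenvectors_in_def by auto
    then have "closed_cspan (e ` {n. cinner f (r n) \<noteq> 0}) \<subseteq> closed_cspan (eigenvectors_in A T)"
      by (rule closed_cspan_mono)
    moreover have "f \<in> closed_cspan (e ` {n. cinner f (r n) \<noteq> 0})"
      using A(2) f by (intro mem_closed_cspan_support) auto
    ultimately show "f \<in> closed_cspan (eigenvectors_in A T)" by (rule subsetD)
  qed
qed

text \<open>Completeness of the eigenvectors in the whole space is the case
  \<open>A = M\<close>.\<close>

lemma T_spectral_synthesis: "admits_spectral_synthesis M T"
  unfolding admits_spectral_synthesis_def
  using T_bounded_operator closed_cspan_eigenvectors closed_csubspace_M T_mem_M by auto

end

theorem theorem1p2:
  fixes l :: "nat \<Rightarrow> real" and u :: "nat \<Rightarrow> complex" and \<rho> :: real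
    and M :: "L2 set" and r :: "nat \<Rightarrow> L2" and T :: "L2 \<Rightarrow> L2"
  assumes l_mono: "strict_mono l"
    and l_pos: "\<And>n. 0 < l n"
    and l_summable: "summable (\<lambda>n. 1 / l n)"
    and l_gap: "0 < (INF n. l (Suc n) - l n)"
    and M_def: "M = closed_cspan (range (\<lambda>n. power_vec (l n)))"
    and r_mem: "\<And>n. r n \<in> M"
    and r_biorth: "biorthogonal (\<lambda>n. power_vec (l n)) r"
    and u_inj: "inj u"
    and u_nonzero: "\<And>n. u n \<noteq> 0"
    and rho: "0 < \<rho>" "\<rho> < 1"
    and u_bound: "\<And>n. cmod (u n) \<le> \<rho> powr l n"
    and T_def: "\<And>f. f \<in> M \<Longrightarrow>
       T f = abs_L2 (\<lambda>x. \<Sum>n. cinner f (r n) * u n * power_fun (l n) x)"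
  shows "(\<forall>f\<in>M.
            (\<forall>x\<in>{0<..<1}. summable (\<lambda>n. cinner f (r n) * u n * power_fun (l n) x)) \<and>
            square_integrable (\<lambda>x. \<Sum>n. cinner f (r n) * u n * power_fun (l n) x)) \<and>
         compact_operator_on M T \<and>
         \<not> normal_operator_on M T \<and>
         admits_spectral_synthesis M T"
proof -
  \<comment> \<open>Strict monotonicity bounds the gaps below by 0, so their infimum is a true lower
    bound and can serve as the gap constant \<open>\<delta>\<close>.\<close>
  have bdd: "bdd_below (range (\<lambda>n. l (Suc n) - l n))"
    using strict_mono_less[OF l_mono] by (intro bdd_belowI[of _ 0]) (auto simp: less_imp_le)
  have gap: "l n + (INF n. l (Suc n) - l n) \<le> l (Suc n)" for n
    using cINF_lower[OF bdd, of n] by simp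
  interpret muntz_operator l "INF n. l (Suc n) - l n" r M u \<rho> T
    by unfold_locales (fact l_pos l_gap gap l_summable M_def r_mem r_biorth u_inj u_nonzero rho u_bound T_def)+
  show ?thesis
    using power_series_summable[OF summable_norm_expansion[OF summable_norm_r_u] l_nonneg]
      power_series_square_integrable[OF summable_norm_expansion[OF summable_norm_r_u] l_nonneg]
      T_compact T_not_normal T_spectral_synthesis
    by simp
qed

end
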